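(* Let $\mathcal{A}:\mathbb{R}^{m\times n}\to\mathbb{R}^p$ be a linear operator, let $\mathbf{X}^\star\in\mathbb{R}^{m\times n}$ have rank $r$, let $\mathbf{y}=\mathcal{A}\mathbf{X}^\star+\boldsymbol{\varepsilon}$ with $\boldsymbol{\varepsilon}\in\mathbb{R}^p$, and let $f(\mathbf{X})=\|\mathbf{y}-\mathcal{A}\mathbf{X}\|_2^2$. Let $\rho\ge 2$ be an integer with $\ell:=r+\rho\le\min\{m,n\}$, put $\epsilon=\frac{r}{\rho-1}$, and let $c$ be an integer such that $\ell=(c-1)r$. Assume that $\mathcal{A}$ satisfies the rank restricted isometry property at ranks $2r$ and $cr$ with constants $\delta_{2r},\delta_{cr}<1$, and that $\|\mathcal{A}\|^2\le mn/p$. Let $(\mathbf{X}_i)$ be generated by the iteration $$\mathbf{X}_{i+1}=\mathcal{P}_r^\epsilon\big(\mathbf{X}_i-\mu_i\nabla f(\mathbf{X}_i)\big)\quad\text{or}\quad \mathbf{X}_{i+1}=\mathcal{P}_{\mathcal{C}}\Big(\mathcal{P}_r^\epsilon\big(\mathbf{X}_i-\mu_i\nabla f(\mathbf{X}_i)\big)\Big),$$ with step size $\mu_i=\frac{1}{2(1+\delta_{cr})}$, where $\mathcal{P}_r^\epsilon$ is the randomized approximate rank-$r$ projector and $\mathcal{C}$ is an admissible convex constraint set (both defined in the context). Let $C\ge 4$ be a constant and suppose $f(\mathbf{X}_i)>C^2\|\boldsymbol{\varepsilon}\|_2^2$. Then $$\mathbb{E}\, f(\mathbf{X}_{i+1})\le\theta\,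 f(\mathbf{X}_i)+\tau\|\boldsymbol{\varepsilon}\|_2^2,$$ where $\theta$ and $\tau$ satisfy $$\theta\le 12\cdot\frac{1+\delta_{2r}}{1-\delta_{cr}}\cdot\left(\frac{\epsilon}{1+\delta_{cr}}\cdot\frac{mn}{p}+(1+\epsilon)\frac{3\delta_{cr}}{1-\delta_{2r}}\right),$$ $$\tau\le\frac{1+\delta_{2r}}{1-\delta_{cr}}\cdot\left(12\,(1+\epsilon)\left(1+\frac{2\delta_{cr}}{1-\delta_{2r}}\right)+8\right),$$ and the expectation is with respect to the Gaussian random matrix drawn in computing $\mathcal{P}_r^\epsilon$ at that iteration (with $\mathbf{X}_i$ given). Moreover, if $\theta\le\theta_\infty<1$ for all iterations, then $$\lim_{i\to\infty}\mathbb{E}\, f(\mathbf{X}_i)\le\max\Big\{C^2,\frac{\tau}{1-\theta_\infty}\Big\}\|\boldsymbol{\varepsilon}\|_2^2.$$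
   Context: Rank restricted isometry property (R-RIP): $\mathcal{A}$ satisfies the R-RIP at rank $s$ with constant $\delta_s$ if $(1-\delta_s)\|\mathbf{X}\|_F^2\le\|\mathcal{A}\mathbf{X}\|_2^2\le(1+\delta_s)\|\mathbf{X}\|_F^2$ for all $\mathbf{X}\in\mathbb{R}^{m\times n}$ with $\mathrm{rank}(\mathbf{X})\le s$; $\delta_s=\delta_s(\mathcal{A})$ denotes the smallest such constant (so $\delta_s$ is nondecreasing in $s$). $\|\mathcal{A}\|$ is the operator norm of $\mathcal{A}$ from $(\mathbb{R}^{m\times n},\|\cdot\|_F)$ to $(\mathbb{R}^p,\|\cdot\|_2)$. The gradient is $\nabla f(\mathbf{X})=2\mathcal{A}^*(\mathcal{A}\mathbf{X}-\mathbf{y})$, with $\mathcal{A}^*$ the adjoint of $\mathcal{A}$. Randomized approximate projector $\mathcal{P}_r^\epsilon$ (randomized SVD with target rank $r$, oversampling $\rho$, no power iterations): given $\mathbf{Y}\in\mathbb{R}^{m\times n}$, draw a fresh $n\times\ell$ matrix $\Omega$ with i.i.d. standard Gaussian entries, independent of everything drawn before; let $Q$ be a matrix whose columns form an orthonormal basis (obtained by QR) of the range of $\mathbf{Y}\Omega$; set $\widetilde{\mathbf{Y}}=QQ^T\mathbf{Y}$ (rank at most $\ell$); the output $\mathcal{P}_r^\epsilon(\mathbf{Y})$ is the best rank-$r$ approximation in Frobenius norm of $\widetilde{\mathbf{Y}}$ (truncation of its SVD to the $r$ largest singular values). The initial point $\mathbf{X}_0$ has rank at most $r$. Admissible constraint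 set $\mathcal{C}$: a closed convex, unitarily invariant set with $\mathbf{X}^\star\in\mathcal{C}$ such that the projection onto $\{\mathbf{X}:\mathrm{rank}(\mathbf{X})\le r\}\cap\mathcal{C}$ equals $\mathcal{P}_{\mathcal{C}}\circ\mathcal{P}_r$, where $\mathcal{P}_{\mathcal{C}}$ is the orthogonal (Frobenius) projection onto $\mathcal{C}$ and $\mathcal{P}_r$ is the (Frobenius) projection onto the matrices of rank at most $r$. Main examples (with $m=n$): $\{\mathbf{X}\succeq 0\}$ and $\{\mathbf{X}\succeq 0,\ \mathrm{trace}(\mathbf{X})=1\}$; for the latter, $\mathcal{P}_{\mathcal{C}}$ is understood to act within the subspace of the rank-$r$ factors, so that it does not increase the rank. *)

theory Defs
  imports "HOL-Probability.Probability"
begin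

text \<open>
  An \<open>m \<times> n\<close> real matrix is an element of \<open>real^'n^'m\<close>. The library's norm and inner product on this
  type are the Frobenius norm and the Frobenius inner product. Consequently \<open>onorm\<close>, \<open>adjoint\<close>
  and \<open>closest_point\<close> are the operator norm, adjoint and projection with respect to them.
\<close>

definition rip :: "(real^'n^'m \<Rightarrow> real^'p) \<Rightarrow> nat \<Rightarrow> real \<Rightarrow> bool" where
  "rip A s d \<longleftrightarrow> (\<forall>X. rank X \<le> s \<longrightarrow>
     (1 - d) * (norm X)\<^sup>2 \<le> (norm (A X))\<^sup>2 \<and> (norm (A X))\<^sup>2 \<le> (1 + d) * (norm X)\<^sup>2)"

text \<open>
  For linear \<open>A\<close> and \<open>s \<ge> 1\<close> the set below is nonempty, closed and bounded below by \<open>0\<close>, so the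
  infimum is the smallest admissible constant.
\<close>

definition rip_const :: "(real^'n^'m \<Rightarrow> real^'p) \<Rightarrow> nat \<Rightarrow> real" where
  "rip_const A s = Inf {d. rip A s d}"

definition objective :: "(real^'n^'m \<Rightarrow> real^'p) \<Rightarrow> real^'p \<Rightarrow> real^'n^'m \<Rightarrow> real" where
  "objective A y X = (norm (y - A X))\<^sup>2"

definition gradient :: "(real^'n^'m \<Rightarrow> real^'p) \<Rightarrow> real^'p \<Rightarrow> real^'n^'m \<Rightarrow> real^'n^'m" where
  "gradient A y X = 2 *\<^sub>R adjoint A (A X - y)"

text \<open>Projection onto a set that need not be convex: \<open>Z\<close> is one of the points of \<open>S\<close> nearest to \<open>Y\<close>.\<close>

definition is_projection :: "'a::metric_space set \<Rightarrow> 'a \<Rightarrow> 'a \<Rightarrow> bool" where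
  "is_projection S Y Z \<longleftrightarrow> Z \<in> S \<and> (\<forall>W\<in>S. dist Y Z \<le> dist Y W)"

definition low_rank :: "nat \<Rightarrow> (real^'n^'m) set" where
  "low_rank r = {X. rank X \<le> r}"

text \<open>
  In the randomized SVD, the columns of \<open>Q\<close> are an orthonormal basis of the range of \<open>Y \<Omega>\<close>. Their
  number is the rank of \<open>Y \<Omega>\<close>, which can be smaller than the number of columns of \<open>\<Omega>\<close>, so the
  columns are given as a set \<open>B\<close>, and \<open>Q Q\<^sup>T Y\<close> is the sum of the matrices \<open>q (q\<^sup>T Y)\<close> over \<open>q \<in> B\<close>.
\<close>

definition orthonormal_basis_of :: "(real^'m) set \<Rightarrow> (real^'m) set \<Rightarrow> bool" where
  "orthonormal_basis_of S B \<longleftrightarrow> pairwise orthogonal B \<and> (\<forall>q\<in>B. norm q = 1) \<and> span B = S"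

definition compress :: "(real^'m) set \<Rightarrow> real^'n^'m \<Rightarrow> real^'n^'m" where
  "compress B Y = (\<Sum>q\<in>B. (\<chi> i j. q $ i * (q v* Y) $ j))"

definition rsvd_output :: "nat \<Rightarrow> real^'n^'m \<Rightarrow> real^'l^'n \<Rightarrow> real^'n^'m \<Rightarrow> bool" where
  "rsvd_output r Y \<Omega> Z \<longleftrightarrow>
     (\<exists>B. orthonormal_basis_of (range ((*v) (Y ** \<Omega>))) B \<and> is_projection (low_rank r) (compress B Y) Z)"

text \<open>
  The truncated SVD is not unique when the \<open>r\<close>-th and the following singular value coincide. The
  projector is therefore any function of the input and the drawn matrix that returns a valid
  output. Measurability makes its outputs random variables.
\<close>

definition randomized_projector ::
  "nat \<Rightarrow> (real^'n^'m \<Rightarrow> real^'l^'n \<Rightarrow> real^'n^'m) \<Rightarrow> bool" where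
  "randomized_projector r P \<longleftrightarrow>
     (\<forall>Y \<Omega>. rsvd_output r Y \<Omega> (P Y \<Omega>)) \<and> (\<lambda>(Y, \<Omega>). P Y \<Omega>) \<in> borel_measurable borel"

definition iid_standard_gaussian ::
  "'w measure \<Rightarrow> (nat \<Rightarrow> 'w \<Rightarrow> real^'l^'n) \<Rightarrow> bool" where
  "iid_standard_gaussian M G \<longleftrightarrow>
     prob_space.indep_vars M (\<lambda>_. borel) (\<lambda>(i, j, k) \<omega>. G i \<omega> $ j $ k) (UNIV :: (nat \<times> 'n \<times> 'l) set) \<and>
     (\<forall>i j k. distributed M lborel (\<lambda>\<omega>. G i \<omega> $ j $ k) std_normal_density)"

text \<open>
  Invariance under \<open>X \<mapsto> U X V\<^sup>T\<close> for all orthogonal \<open>U\<close>, \<open>V\<close> or, for square matrices, only under the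
  conjugations \<open>X \<mapsto> U X U\<^sup>T\<close>, as for the positive semidefinite cone. The bijection \<open>\<sigma>\<close>, which
  exists only if \<open>m = n\<close>, identifies row indices with column indices.
\<close>

definition unitarily_invariant :: "(real^'n^'m) set \<Rightarrow> bool" where
  "unitarily_invariant K \<longleftrightarrow>
     (\<forall>U V. orthogonal_matrix U \<and> orthogonal_matrix V \<longrightarrow> (\<forall>X\<in>K. U ** X ** transpose V \<in> K)) \<or>
     (\<exists>\<sigma> :: 'm \<Rightarrow> 'n. bij \<sigma> \<and> (\<forall>U. orthogonal_matrix U \<longrightarrow>
        (\<forall>X\<in>K. U ** X ** transpose (\<chi> a b. U $ inv \<sigma> a $ inv \<sigma> b) \<in> K)))"

text \<open>
  \<open>PK\<close> is the map applied after the randomized projector. In the first alternative it is the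
  orthogonal projection onto \<open>K\<close>, and its composition with the projection onto \<open>low_rank r\<close>
  (whichever nearest point the latter picks) is a projection onto \<open>low_rank r \<inter> K\<close>. In the second
  alternative it acts among matrices of rank at most \<open>r\<close>, so that it cannot increase the rank. This
  is needed for \<open>{X \<succeq> 0, trace X = 1}\<close>, where the orthogonal projection can raise the rank. It also
  covers the orthogonal projection onto \<open>{X \<succeq> 0}\<close>, which does not raise the rank but violates the
  first alternative at matrices \<open>Y\<close> having a negative eigenvalue of dominant modulus.
\<close>

definition admissible_constraint ::
  "nat \<Rightarrow> real^'n^'m \<Rightarrow> (real^'n^'m) set \<Rightarrow> (real^'n^'m \<Rightarrow> real^'n^'m) \<Rightarrow> bool" where
  "admissible_constraint r Xs K PK \<longleftrightarrow>
     closed K \<and> convex K \<and> unitarily_invariant K \<and> Xs \<in> K \<and>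
     (PK = closest_point K \<and>
        (\<forall>Y Z. is_projection (low_rank r) Y Z \<longrightarrow> is_projection (low_rank r \<inter> K) Y (PK Z)) \<or>
      PK \<in> borel_measurable borel \<and>
        (\<forall>Z\<in>low_rank r. is_projection (low_rank r \<inter> K) Z (PK Z)))"

end

(*
  A gradient step V = W - mu grad f(W) of step size 1/(2(1 + dc)) minimises the quadratic upper model of f at W,
  so for Z of rank at most r, f(Z) exceeds the minimum of the model by at most (1 + dc) |V - Z|^2. The
  randomized truncated SVD satisfies E |V - Z|^2 <= (1 + eps) |V - X|^2 for every X of rank at most r:
  Z is at least as close to V as V Omega Omega_1^+ H^T, where the columns of H span the row space of X and
  Omega_1 = H^T Omega, and E |Omega_1^+|^2 = r/(rho - 1) because the squared column norms of the pseudoinverse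
  are reciprocals of squared distances of a Gaussian vector to an independent subspace. Taking X = X* and
  using the restricted isometry property gives the contraction. The map after the projector moves Z by
  at most |Z - X*|, which costs only a constant factor. This bounds E f(X_(i+1)) by an affine function of f(X_i),
  and the affine recursion gives the limit.
*)
theory Submission
  imports Defs
begin

section \<open>Standard Gaussian measures\<close>

text \<open>The dual vectors that form the columns of the right inverse exist only almost surely,
  and their size is controlled only in mean. Integrals with values in \<open>ennreal\<close> settle
  both at once: there \<open>inverse 0\<close> is infinite, so a finite mean of the inverse squared
  distance bounds the size and also excludes degenerate rows. The dual vectors depend only on the
  rows in \<open>I\<close>, while the other rows enter the error linearly; integrating over the
  other rows first therefore leaves a plain second moment. In the deterministic part,
  \<open>(norm (g W))\<^sup>2 / (4 * (1 + dc))\<close> occurs with a minus sign in the descent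
  estimate and with the factor \<open>1 + \<epsilon>\<close> in the estimate at \<open>Xs\<close>.
  Only \<open>\<epsilon>\<close> times this term survives; here the bound on the operator norm
  enters, and this is the origin of the first summand of \<open>\<theta>\<close>. An iterate is a
  measurable function of the matrices drawn before it, so Fubini on a product law takes the place of
  conditional expectation. Each iterate is bounded by a deterministic constant, which supplies
  integrability.\<close>

lemma measurable_vec_lambda [measurable (raw)]:
  fixes f :: "'i::finite \<Rightarrow> 'b \<Rightarrow> 'a::euclidean_space"
  assumes [measurable]: "\<And>i. f i \<in> borel_measurable N"
  shows "(\<lambda>x. \<chi> i. f i x) \<in> borel_measurable N"
  by (subst borel_measurable_euclidean_space) (auto simp: Basis_vec_def inner_axis)

lemma measurable_vec_nth [measurable (raw)]:
  fixes f :: "'b \<Rightarrow> 'a::euclidean_space^'i::finite"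
  assumes [measurable]: "f \<in> borel_measurable N"
  shows "(\<lambda>x. f x $ i) \<in> borel_measurable N"
proof -
  have "(\<lambda>v::'a^'i. v $ i) \<in> borel_measurable borel"
    by (intro borel_measurable_continuous_onI continuous_intros)
  from measurable_compose[OF assms this] show ?thesis by simp
qed

text \<open>Uniqueness of Haar measure by Fubini: integrating \<open>g x * h (y - x)\<close> against both measures in
  either order shows that they are proportional, and an isometry fixes the unit ball.\<close>

lemma lborel_distr_isometry:
  fixes f :: "'a::euclidean_space \<Rightarrow> 'a"
  assumes f: "orthogonal_transformation f"
  shows "distr lborel borel f = lborel"
proof -
  have lin: "linear f" and nrm: "\<And>x. norm (f x) = norm x"
    using f by (auto simp: orthogonal_transformation)
  have bij: "bij f" using f by (rule orthogonal_transformation_bij)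
  have [measurable]: "f \<in> borel_measurable borel"
    by (intro borel_measurable_continuous_onI linear_continuous_on linear_conv_bounded_linear[THEN iffD1] lin)
  let ?m = "distr lborel borel f"
  have shift: "(\<integral>\<^sup>+x. g (x + y) \<partial>?m) = (\<integral>\<^sup>+x. g x \<partial>?m)"
    if [measurable]: "g \<in> borel_measurable borel" for g and y :: 'a
  proof -
    obtain z where z: "f z = y" using bij by (metis bij_pointE)
    have "(\<integral>\<^sup>+x. g (x + y) \<partial>?m) = (\<integral>\<^sup>+x. g (f (z + x)) \<partial>lborel)"
      by (subst nn_integral_distr) (auto simp: linear_add[OF lin] z add.commute)
    also have "\<dots> = (\<integral>\<^sup>+x. g (f x) \<partial>distr lborel borel ((+) z))"
      by (subst nn_integral_distr) auto
    also have "\<dots> = (\<integral>\<^sup>+x. g x \<partial>?m)"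
      by (simp add: lborel_distr_plus nn_integral_distr)
    finally show ?thesis .
  qed
  have shiftl: "(\<integral>\<^sup>+x. g (x + y) \<partial>lborel) = (\<integral>\<^sup>+x. g x \<partial>lborel)"
    if [measurable]: "g \<in> borel_measurable borel" for g and y :: 'a
  proof -
    have "(\<integral>\<^sup>+x. g (x + y) \<partial>lborel) = (\<integral>\<^sup>+x. g x \<partial>distr lborel borel ((+) y))"
      by (subst nn_integral_distr) (auto simp: add.commute)
    then show ?thesis by (simp add: lborel_distr_plus)
  qed
  have ball: "emeasure ?m (cball 0 r) = emeasure lborel (cball (0::'a) r)" for r
  proof -
    have "f -` cball 0 r = cball (0::'a) r" by (auto simp: nrm)
    then show ?thesis by (simp add: emeasure_distr)
  qed
  have fin: "emeasure lborel (cball (0::'a) r) \<noteq> \<top>" for r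
    using emeasure_lborel_cball_finite[of "0::'a" r] by (auto simp: less_top)
  have sf: "sigma_finite_measure ?m"
  proof
    have "\<exists>n. x \<in> cball 0 (real n)" for x :: 'a
      by (simp add: real_arch_simple)
    then show "\<exists>A. countable A \<and> A \<subseteq> sets ?m \<and> \<Union> A = space ?m \<and> (\<forall>a\<in>A. emeasure ?m a \<noteq> \<infinity>)"
      by (intro exI[of _ "range (\<lambda>n::nat. cball 0 (real n))"])
         (auto simp: ball fin)
  qed
  interpret pair_sigma_finite ?m "lborel :: 'a measure"
    using sf by (simp add: pair_sigma_finite_def lborel.sigma_finite_measure_axioms)
  \<comment> \<open>The unit ball is symmetric, which removes the reflection that the substitution
    in \<open>key\<close> produces, and it has the same finite nonzero volume under both measures,
    so that this factor cancels at the end.\<close>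
  define h :: "'a \<Rightarrow> ennreal" where "h = indicator (cball 0 1)"
  have hb [measurable]: "h \<in> borel_measurable borel" unfolding h_def by (intro borel_measurable_indicator) simp
  have hm: "h (- x) = h x" for x by (auto simp: h_def indicator_def)
  have key: "(\<integral>\<^sup>+x. g x \<partial>?m) * (\<integral>\<^sup>+y. h y \<partial>lborel) = (\<integral>\<^sup>+x. g x \<partial>lborel) * (\<integral>\<^sup>+y. h y \<partial>?m)"
    if [measurable]: "g \<in> borel_measurable borel" for g
  proof -
    have "(\<integral>\<^sup>+x. g x \<partial>?m) * (\<integral>\<^sup>+y. h y \<partial>lborel) = (\<integral>\<^sup>+x. g x * (\<integral>\<^sup>+y. h y \<partial>lborel) \<partial>?m)"
      by (simp add: nn_integral_multc)
    also have "\<dots> = (\<integral>\<^sup>+x. \<integral>\<^sup>+y. g x * h (y - x) \<partial>lborel \<partial>?m)"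
    proof (rule nn_integral_cong)
      fix x :: 'a
      have "(\<integral>\<^sup>+y. h (y - x) \<partial>lborel) = (\<integral>\<^sup>+y. h y \<partial>lborel)"
        using shiftl[OF hb, of "- x"] by simp
      then show "g x * (\<integral>\<^sup>+y. h y \<partial>lborel) = (\<integral>\<^sup>+y. g x * h (y - x) \<partial>lborel)"
        by (subst nn_integral_cmult) auto
    qed
    also have "\<dots> = (\<integral>\<^sup>+y. \<integral>\<^sup>+x. g x * h (y - x) \<partial>?m \<partial>lborel)"
      by (rule Fubini'[symmetric]) simp
    also have "\<dots> = (\<integral>\<^sup>+y. \<integral>\<^sup>+x. g (x + y) * h (- x) \<partial>?m \<partial>lborel)"
    proof (rule nn_integral_cong)
      fix y :: 'a
      show "(\<integral>\<^sup>+x. g x * h (y - x) \<partial>?m) = (\<integral>\<^sup>+x. g (x + y) * h (- x) \<partial>?m)"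
        using shift[of "\<lambda>x. g x * h (y - x)" y] by simp
    qed
    also have "\<dots> = (\<integral>\<^sup>+x. \<integral>\<^sup>+y. g (x + y) * h (- x) \<partial>lborel \<partial>?m)"
      by (rule Fubini') simp
    also have "\<dots> = (\<integral>\<^sup>+x. (\<integral>\<^sup>+y. g y \<partial>lborel) * h x \<partial>?m)"
      using shiftl[of g] by (simp add: nn_integral_multc hm add.commute)
    also have "\<dots> = (\<integral>\<^sup>+x. g x \<partial>lborel) * (\<integral>\<^sup>+y. h y \<partial>?m)"
      by (subst nn_integral_cmult) auto
    finally show ?thesis .
  qed
  show ?thesis
  proof (rule measure_eqI)
    fix A assume "A \<in> sets ?m"
    then have A [measurable]: "A \<in> sets borel" by simp
    define u where "u = emeasure lborel (cball (0::'a) 1)"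
    have u: "u \<noteq> 0" "u \<noteq> \<top>"
      using content_cball_pos[of 1 "0::'a"] by (auto simp: u_def fin measure_def)
    have "emeasure ?m A * u = emeasure lborel A * u"
      using key[of "indicator A"] by (simp add: ball u_def h_def)
    then show "emeasure ?m A = emeasure lborel A"
      using u by (simp add: mult.commute[of _ u] ennreal_mult_cancel_left)
  qed simp
qed

text \<open>A density on the whole Euclidean space, depending on the norm alone, makes invariance
  under isometries immediate. The same definition serves real numbers, rows and matrices; the
  product structure is derived from it afterwards.\<close>

definition std_gaussian :: "'a::euclidean_space measure" where
  "std_gaussian = density lborel (\<lambda>x. ennreal ((1 / sqrt (2 * pi)) ^ DIM('a) * exp (- (norm x)\<^sup>2 / 2)))"

lemma sets_std_gaussian [measurable_cong, simp]: "sets std_gaussian = sets borel"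
  and space_std_gaussian [simp]: "space std_gaussian = UNIV"
  by (simp_all add: std_gaussian_def)

lemma std_gaussian_distr_isometry:
  fixes f :: "'a::euclidean_space \<Rightarrow> 'a"
  assumes f: "orthogonal_transformation f"
  shows "distr std_gaussian borel f = std_gaussian"
proof -
  let ?d = "\<lambda>x::'a. ennreal ((1 / sqrt (2 * pi)) ^ DIM('a) * exp (- (norm x)\<^sup>2 / 2))"
  have lin: "linear f" and nrm: "\<And>x. norm (f x) = norm x"
    using f by (auto simp: orthogonal_transformation)
  have [measurable]: "f \<in> borel_measurable borel"
    by (intro borel_measurable_continuous_onI linear_continuous_on linear_conv_bounded_linear[THEN iffD1] lin)
  have "distr (density lborel (\<lambda>x. ?d (f x))) borel f = density (distr lborel borel f) ?d"
    by (subst density_distr) (auto cong: distr_cong)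
  then show ?thesis
    by (simp add: std_gaussian_def lborel_distr_isometry[OF f] nrm)
qed

lemma std_gaussian_real: "std_gaussian = density lborel (\<lambda>x::real. ennreal (std_normal_density x))"
  by (simp add: std_gaussian_def std_normal_density_def)

text \<open>Lebesgue measure is determined by the volumes of boxes, and a box of vectors is a
  product of boxes in the component space. The components range over any Euclidean space, so that a
  matrix can be treated as a vector of rows.\<close>

lemma lborel_vec:
  "distr (PiM UNIV (\<lambda>_::'i::finite. lborel)) borel vec_lambda = (lborel :: ('a::euclidean_space^'i) measure)"
proof (rule lborel_eqI[symmetric])
  interpret product_sigma_finite "\<lambda>_::'i. lborel :: 'a measure" ..
  fix l u :: "'a^'i"
  assume lu: "\<And>b. b \<in> Basis \<Longrightarrow> l \<bullet> b \<le> u \<bullet> b"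
  have le: "l $ i \<bullet> b \<le> u $ i \<bullet> b" if "b \<in> Basis" for i b
    using lu[of "axis i b"] that by (simp add: inner_axis)
  have m [measurable]: "(\<lambda>x. \<chi> i. x i) \<in> borel_measurable (PiM UNIV (\<lambda>_::'i. lborel :: 'a measure))"
    by measurable
  have pre: "vec_lambda -` box l u = (\<Pi>\<^sub>E i\<in>UNIV. box (l $ i) (u $ i))"
    by (fastforce simp: box_def Basis_vec_def inner_axis PiE_def Pi_def)
  have "emeasure (distr (PiM UNIV (\<lambda>_::'i. lborel)) borel vec_lambda) (box l u)
      = emeasure (PiM UNIV (\<lambda>_::'i. lborel)) (\<Pi>\<^sub>E i\<in>UNIV. box (l $ i) (u $ i))"
    using m by (subst emeasure_distr) (auto simp: pre space_PiM)
  also have "\<dots> = (\<Prod>i\<in>UNIV. ennreal (\<Prod>b\<in>Basis. (u $ i - l $ i) \<bullet> b))"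
    by (subst emeasure_PiM) (auto simp: le emeasure_lborel_box)
  also have "\<dots> = ennreal (\<Prod>i\<in>UNIV. \<Prod>b\<in>Basis. (u $ i - l $ i) \<bullet> b)"
    by (rule prod_ennreal) (auto intro!: prod_nonneg simp: le inner_diff_left)
  also have "(\<Prod>i\<in>UNIV. \<Prod>b\<in>Basis. (u $ i - l $ i) \<bullet> b) = (\<Prod>b\<in>Basis. (u - l) \<bullet> b)"
  proof -
    have "bij_betw (\<lambda>(i, b). axis i b) (UNIV \<times> (Basis :: 'a set)) (Basis :: ('a^'i) set)"
      by (fastforce simp: bij_betw_def inj_on_def axis_eq_axis Basis_vec_def)
    from prod.reindex_bij_betw[OF this, of "\<lambda>b. (u - l) \<bullet> b"]
    have "(\<Prod>b\<in>Basis. (u - l) \<bullet> b) = (\<Prod>(i, b)\<in>UNIV \<times> (Basis :: 'a set). (u - l) \<bullet> axis i b)"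
      by (simp add: split_def)
    then show ?thesis by (simp add: prod.cartesian_product inner_axis)
  qed
  finally show "emeasure (distr (PiM UNIV (\<lambda>_::'i. lborel)) borel vec_lambda) (box l u)
      = ennreal (\<Prod>b\<in>Basis. (u - l) \<bullet> b)" .
qed simp

lemma prob_space_std_gaussian_real: "prob_space (std_gaussian :: real measure)"
  by (simp add: std_gaussian_real prob_space_normal_density)

lemma PiM_density:
  fixes N :: "'i::finite \<Rightarrow> 'a measure"
  assumes N: "\<And>i. sigma_finite_measure (N i)" and [measurable]: "\<And>i. d i \<in> borel_measurable (N i)"
    and D: "\<And>i. sigma_finite_measure (density (N i) (d i))"
  shows "PiM UNIV (\<lambda>i. density (N i) (d i)) = density (PiM UNIV N) (\<lambda>x. \<Prod>i\<in>UNIV. d i (x i))"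
proof -
  interpret N: product_sigma_finite N by (simp add: product_sigma_finite_def N)
  interpret D: product_sigma_finite "\<lambda>i. density (N i) (d i)" by (simp add: product_sigma_finite_def D)
  have s: "sets (PiM UNIV N) = sets (PiM UNIV (\<lambda>i. density (N i) (d i)))"
    by (rule sets_PiM_cong) auto
  show ?thesis
  proof (rule D.PiM_eqI[symmetric])
    fix A assume A: "\<And>i. i \<in> UNIV \<Longrightarrow> A i \<in> sets (density (N i) (d i))"
    then have [measurable]: "\<And>i. A i \<in> sets (N i)" by simp
    have ind: "indicator (Pi\<^sub>E UNIV A) x = (\<Prod>i\<in>UNIV. indicator (A i) (x i) :: ennreal)" for x
      by (auto simp: indicator_def PiE_def Pi_def prod_eq_1_iff intro!: prod_zero[symmetric])
    have "emeasure (density (PiM UNIV N) (\<lambda>x. \<Prod>i\<in>UNIV. d i (x i))) (Pi\<^sub>E UNIV A)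
        = (\<integral>\<^sup>+x. (\<Prod>i\<in>UNIV. d i (x i) * indicator (A i) (x i)) \<partial>PiM UNIV N)"
      by (subst emeasure_density) (auto simp: ind prod.distrib)
    also have "\<dots> = (\<Prod>i\<in>UNIV. \<integral>\<^sup>+x. d i x * indicator (A i) x \<partial>N i)"
      by (rule N.product_nn_integral_prod) auto
    also have "\<dots> = (\<Prod>i\<in>UNIV. emeasure (density (N i) (d i)) (A i))"
      by (intro prod.cong refl) (simp add: emeasure_density)
    finally show "emeasure (density (PiM UNIV N) (\<lambda>x. \<Prod>i\<in>UNIV. d i (x i))) (Pi\<^sub>E UNIV A)
      = (\<Prod>i\<in>UNIV. emeasure (density (N i) (d i)) (A i))" .
  qed (simp_all add: s)
qed

text \<open>The squared norm is additive over components, so the exponential factors, and the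
  normalising constant factors with the dimension. The statement is used on two levels: real entries
  form a row, and rows form a matrix.\<close>

lemma std_gaussian_vec:
  assumes "prob_space (std_gaussian :: 'a::euclidean_space measure)"
  shows "(std_gaussian :: ('a^'i::finite) measure) = distr (PiM UNIV (\<lambda>_. std_gaussian)) borel vec_lambda"
proof -
  let ?d = "\<lambda>x::'a. ennreal ((1 / sqrt (2 * pi)) ^ DIM('a) * exp (- (norm x)\<^sup>2 / 2))"
  let ?e = "\<lambda>x::'a^'i. ennreal ((1 / sqrt (2 * pi)) ^ DIM('a^'i) * exp (- (norm x)\<^sup>2 / 2))"
  have m [measurable]: "(\<lambda>x. \<chi> i. x i) \<in> borel_measurable (PiM UNIV (\<lambda>_::'i. lborel :: 'a measure))"
    by measurable
  interpret prob_space "std_gaussian :: 'a measure" by fact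
  have sf: "sigma_finite_measure (density lborel ?d)"
    using sigma_finite_measure_axioms by (simp add: std_gaussian_def)
  have "PiM UNIV (\<lambda>_::'i. std_gaussian :: 'a measure)
      = density (PiM UNIV (\<lambda>_. lborel)) (\<lambda>x. \<Prod>i\<in>UNIV. ?d (x i))"
    unfolding std_gaussian_def
    by (rule PiM_density)
       (use sf in \<open>auto simp: lborel.sigma_finite_measure_axioms\<close>)
  also have "(\<lambda>x. \<Prod>i\<in>UNIV. ?d (x i)) = (\<lambda>x::'i \<Rightarrow> 'a. ?e (\<chi> i. x i))"
  proof
    fix x :: "'i \<Rightarrow> 'a"
    have n: "(norm (\<chi> i. x i))\<^sup>2 = (\<Sum>i\<in>UNIV. (norm (x i))\<^sup>2)"
      by (simp add: norm_vec_def L2_set_def sum_nonneg)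
    show "(\<Prod>i\<in>UNIV. ?d (x i)) = ?e (\<chi> i. x i)"
      by (subst prod_ennreal)
         (auto simp: prod.distrib n exp_sum[symmetric] sum_negf[symmetric] sum_divide_distrib power_mult[symmetric] mult.commute)
  qed
  also have "distr (density (PiM UNIV (\<lambda>_. lborel)) (\<lambda>x::'i \<Rightarrow> 'a. ?e (\<chi> i. x i))) borel vec_lambda
      = density (distr (PiM UNIV (\<lambda>_. lborel)) borel vec_lambda) ?e"
    using m by (subst density_distr) (auto cong: distr_cong)
  finally show ?thesis
    by (simp add: lborel_vec std_gaussian_def)
qed

lemma prob_space_std_gaussian_vec:
  assumes "prob_space (std_gaussian :: 'a::euclidean_space measure)"
  shows "prob_space (std_gaussian :: ('a^'i::finite) measure)"
proof -
  have m [measurable]: "(\<lambda>x. \<chi> i. x i) \<in> borel_measurable (PiM UNIV (\<lambda>_::'i. std_gaussian :: 'a measure))"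
    by measurable
  have "prob_space (PiM UNIV (\<lambda>_::'i. std_gaussian :: 'a measure))"
    by (intro prob_space_PiM assms)
  then show ?thesis
    unfolding std_gaussian_vec[OF assms] using m by (intro prob_space.prob_space_distr) auto
qed

lemma std_gaussian_marginal:
  assumes "prob_space (std_gaussian :: 'a::euclidean_space measure)"
  shows "distr (std_gaussian :: ('a^'i::finite) measure) borel (\<lambda>x. x $ i) = std_gaussian"
proof -
  have m [measurable]: "(\<lambda>x. \<chi> i. x i) \<in> borel_measurable (PiM UNIV (\<lambda>_::'i. std_gaussian :: 'a measure))"
    by measurable
  have "distr (std_gaussian :: ('a^'i::finite) measure) borel (\<lambda>x. x $ i)
      = distr (PiM UNIV (\<lambda>_::'i. std_gaussian :: 'a measure)) std_gaussian (\<lambda>x. x i)"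
    unfolding std_gaussian_vec[OF assms] using m
    by (subst distr_distr) (auto simp: comp_def intro!: distr_cong)
  also have "\<dots> = std_gaussian"
    by (intro distr_PiM_component assms) auto
  finally show ?thesis .
qed

text \<open>This is Fubini for the independence of two blocks of components. Overwriting the
  components outside \<open>I\<close> by those of an independent copy keeps both blocks inside one
  index type, so \<open>I\<close> may be an arbitrary set chosen later.\<close>

lemma std_gaussian_resample:
  fixes F :: "'a::euclidean_space^'i::finite \<Rightarrow> ennreal"
  assumes P: "prob_space (std_gaussian :: 'a measure)" and [measurable]: "F \<in> borel_measurable borel"
  shows "(\<integral>\<^sup>+x. F x \<partial>std_gaussian)
    = (\<integral>\<^sup>+x. \<integral>\<^sup>+y. F (\<chi> i. if i \<in> I then x $ i else y $ i) \<partial>std_gaussian \<partial>std_gaussian)"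
proof -
  let ?g = "std_gaussian :: 'a measure" and ?G = "std_gaussian :: ('a^'i) measure"
  let ?P = "PiM UNIV (\<lambda>_::'i. ?g)"
  interpret g: prob_space ?g by (rule P)
  interpret G: prob_space ?G by (rule prob_space_std_gaussian_vec[OF P])
  interpret pr: prob_space ?P by (intro prob_space_PiM P)
  interpret ps: product_sigma_finite "\<lambda>_::'i. ?g" ..
  interpret PP: pair_sigma_finite ?P ?P ..
  have m [measurable]: "(\<lambda>x. \<chi> i. x i) \<in> borel_measurable ?P"
    by measurable
  let ?mer = "\<lambda>(x, y). \<lambda>i. if i \<in> I then x i else y i"
  have mm [measurable]: "?mer \<in> measurable (?P \<Otimes>\<^sub>M ?P) ?P"
    by (rule measurable_PiM_single') (auto simp: space_PiM split_def)
  have eq: "distr (?P \<Otimes>\<^sub>M ?P) ?P ?mer = ?P"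
  proof (rule ps.PiM_eqI)
    fix A :: "'i \<Rightarrow> 'a set"
    assume A: "\<And>i. i \<in> UNIV \<Longrightarrow> A i \<in> sets ?g"
    let ?B = "\<Pi>\<^sub>E i\<in>UNIV. if i \<in> I then A i else UNIV"
    let ?C = "\<Pi>\<^sub>E i\<in>UNIV. if i \<in> I then UNIV else A i"
    have BC: "?B \<in> sets ?P" "?C \<in> sets ?P" "Pi\<^sub>E UNIV A \<in> sets ?P"
      using A by (auto intro!: sets_PiM_I_finite)
    \<comment> \<open>Every component of the merged vector is taken from exactly one of the two
      arguments, so a box pulls back to a rectangle.\<close>
    have pre: "?mer -` (Pi\<^sub>E UNIV A) \<inter> space (?P \<Otimes>\<^sub>M ?P) = ?B \<times> ?C"
      by (auto simp: space_pair_measure space_PiM PiE_def Pi_def split: if_splits)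
    have "emeasure (distr (?P \<Otimes>\<^sub>M ?P) ?P ?mer) (Pi\<^sub>E UNIV A) = emeasure (?P \<Otimes>\<^sub>M ?P) (?B \<times> ?C)"
      by (subst emeasure_distr[OF mm BC(3)]) (simp only: pre)
    also have "\<dots> = emeasure ?P ?B * emeasure ?P ?C"
      by (rule pr.emeasure_pair_measure_Times[OF BC(1,2)])
    also have "\<dots> = (\<Prod>i\<in>UNIV. emeasure ?g (if i \<in> I then A i else UNIV)) * (\<Prod>i\<in>UNIV. emeasure ?g (if i \<in> I then UNIV else A i))"
      using A by (subst (1 2) ps.emeasure_PiM) auto
    also have "\<dots> = (\<Prod>i\<in>UNIV. emeasure ?g (A i))"
      using g.emeasure_space_1 by (subst prod.distrib[symmetric]) (auto intro!: prod.cong)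
    finally show "emeasure (distr (?P \<Otimes>\<^sub>M ?P) ?P ?mer) (Pi\<^sub>E UNIV A) = (\<Prod>i\<in>UNIV. emeasure ?g (A i))" .
  qed auto
  have "(\<integral>\<^sup>+x. F x \<partial>?G) = (\<integral>\<^sup>+x. F (vec_lambda x) \<partial>?P)"
    unfolding std_gaussian_vec[OF P] using m by (subst nn_integral_distr) auto
  also have "\<dots> = (\<integral>\<^sup>+x. F (vec_lambda x) \<partial>distr (?P \<Otimes>\<^sub>M ?P) ?P ?mer)"
    by (simp add: eq)
  also have "\<dots> = (\<integral>\<^sup>+z. F (vec_lambda (?mer z)) \<partial>(?P \<Otimes>\<^sub>M ?P))"
    using m by (subst nn_integral_distr) auto
  also have "\<dots> = (\<integral>\<^sup>+x. \<integral>\<^sup>+y. F (vec_lambda (?mer (x, y))) \<partial>?P \<partial>?P)"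
    using measurable_comp[OF mm, of "\<lambda>x. F (vec_lambda x)" borel] m
    by (subst pr.nn_integral_fst[symmetric]) (auto simp: comp_def)
  also have "\<dots> = (\<integral>\<^sup>+x. \<integral>\<^sup>+y. F (\<chi> i. if i \<in> I then x i else y $ i) \<partial>?G \<partial>?P)"
    unfolding std_gaussian_vec[OF P] using m by (subst nn_integral_distr) (auto cong: if_cong)
  also have "\<dots> = (\<integral>\<^sup>+x. \<integral>\<^sup>+y. F (\<chi> i. if i \<in> I then x $ i else y $ i) \<partial>?G \<partial>?G)"
  proof -
    define H where "H x = (\<integral>\<^sup>+y. F (\<chi> i. if i \<in> I then x $ i else y $ i) \<partial>?G)" for x :: "'a^'i"
    have [measurable]: "H \<in> borel_measurable borel"
      unfolding H_def by measurable
    have "(\<integral>\<^sup>+x. H x \<partial>?G) = (\<integral>\<^sup>+x. H (vec_lambda x) \<partial>?P)"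
      unfolding std_gaussian_vec[OF P] using m by (subst nn_integral_distr) auto
    then show ?thesis by (simp add: H_def cong: if_cong)
  qed
  finally show ?thesis .
qed

text \<open>The witness is the Householder reflection in the hyperplane orthogonal to
  \<open>a - b\<close>. Equality of the norms gives
  \<open>2 * (a \<bullet> w) = w \<bullet> w\<close>, so that exactly \<open>w\<close> is subtracted
  from \<open>a\<close>.\<close>

lemma orthogonal_transformation_exists_euclidean:
  fixes a b :: "'a::euclidean_space"
  assumes "norm a = norm b"
  obtains f where "orthogonal_transformation f" "f a = b"
proof (cases "a = b")
  case True
  then show ?thesis by (intro that[of "\<lambda>x. x"]) (simp_all add: orthogonal_transformation_id)
next
  case False
  define w where "w = a - b"
  define f where "f x = x - (2 * (x \<bullet> w) / (w \<bullet> w)) *\<^sub>R w" for x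
  have w: "w \<bullet> w \<noteq> 0" using False by (simp add: w_def)
  have "linear f"
    by (rule linearI) (simp_all add: f_def algebra_simps inner_left_distrib add_divide_distrib)
  moreover have "f x \<bullet> f y = x \<bullet> y" for x y
    using w by (simp add: f_def inner_diff_left inner_diff_right inner_commute field_simps)
  ultimately have "orthogonal_transformation f"
    by (simp add: orthogonal_transformation_def)
  moreover have "2 * (a \<bullet> w) = w \<bullet> w"
    using norm_eq[of a b] assms by (simp add: w_def inner_diff_left inner_diff_right inner_commute[of b a])
  then have "f a = b" using w by (simp add: f_def w_def)
  ultimately show ?thesis by (rule that)
qed

section \<open>Second moments and mean inverse squared lengths of Gaussian vectors\<close>

lemma prob_space_std_gaussian_rows: "prob_space (std_gaussian :: (real^'l^'n) measure)"
  and prob_space_std_gaussian_cart: "prob_space (std_gaussian :: (real^'l) measure)"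
  by (intro prob_space_std_gaussian_vec prob_space_std_gaussian_real)+

lemma nn_integral_std_gaussian_real_sq: "(\<integral>\<^sup>+x. ennreal (x\<^sup>2) \<partial>std_gaussian) = 1"
proof -
  have "(\<integral>\<^sup>+x. ennreal (x\<^sup>2) \<partial>std_gaussian) = (\<integral>\<^sup>+x. ennreal (std_normal_density x * x ^ (2 * 1)) \<partial>lborel)"
    unfolding std_gaussian_real by (subst nn_integral_density) (auto simp: ennreal_mult'[symmetric])
  also have "\<dots> = ennreal (fact (2 * 1) / (2 ^ 1 * fact 1))"
    using std_normal_moment_even[of 1]
    by (subst nn_integral_eq_integral) (auto simp: has_bochner_integral_iff)
  finally show ?thesis by simp
qed

text \<open>An isometry carries a multiple of a single matrix unit to \<open>a\<close>. By
  invariance the integral becomes the second moment of one entry, scaled by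
  \<open>(norm a)\<^sup>2\<close>.\<close>

lemma nn_integral_std_gaussian_inner_sq:
  fixes a :: "real^'l^'n"
  shows "(\<integral>\<^sup>+x. ennreal ((x \<bullet> a)\<^sup>2) \<partial>std_gaussian) = ennreal ((norm a)\<^sup>2)"
proof -
  obtain i :: 'n and l :: 'l where True by blast
  let ?b = "axis i (axis l (norm a)) :: real^'l^'n"
  have na: "norm (axis i x) = norm x" for x :: "'c::real_normed_vector" and i :: "'d::finite"
    by (simp add: norm_vec_def L2_set_def axis_def if_distrib[of norm] if_distrib[of "\<lambda>x. x\<^sup>2"] cong: if_cong)
  have "norm ?b = norm a" by (simp add: na)
  then obtain f where f: "orthogonal_transformation f" "f ?b = a"
    by (rule orthogonal_transformation_exists_euclidean)
  have [measurable]: "f \<in> borel_measurable borel"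
    using f by (intro borel_measurable_continuous_onI linear_continuous_on)
      (auto simp: orthogonal_transformation_def linear_conv_bounded_linear)
  have "(\<integral>\<^sup>+x. ennreal ((x \<bullet> a)\<^sup>2) \<partial>std_gaussian) = (\<integral>\<^sup>+x. ennreal ((f x \<bullet> f ?b)\<^sup>2) \<partial>std_gaussian)"
    unfolding f(2) by (subst std_gaussian_distr_isometry[OF f(1), symmetric], subst nn_integral_distr) auto
  also have "\<dots> = (\<integral>\<^sup>+x. ennreal ((norm a)\<^sup>2) * ennreal ((x $ i $ l)\<^sup>2) \<partial>(std_gaussian :: (real^'l^'n) measure))"
    using f(1) by (intro nn_integral_cong)
      (simp add: orthogonal_transformation_def inner_axis power_mult_distrib ennreal_mult'[symmetric] mult.commute)
  also have "\<dots> = ennreal ((norm a)\<^sup>2) * (\<integral>\<^sup>+x. ennreal ((x $ i $ l)\<^sup>2) \<partial>(std_gaussian :: (real^'l^'n) measure))"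
    by (rule nn_integral_cmult) simp
  also have "(\<integral>\<^sup>+x. ennreal ((x $ i $ l)\<^sup>2) \<partial>(std_gaussian :: (real^'l^'n) measure))
      = (\<integral>\<^sup>+x. ennreal ((x $ l)\<^sup>2) \<partial>(std_gaussian :: (real^'l) measure))"
    by (subst std_gaussian_marginal[OF prob_space_std_gaussian_cart, of i, symmetric], subst nn_integral_distr) auto
  also have "\<dots> = (\<integral>\<^sup>+x. ennreal (x\<^sup>2) \<partial>std_gaussian)"
    by (subst std_gaussian_marginal[OF prob_space_std_gaussian_real, of l, symmetric], subst nn_integral_distr) auto
  finally show ?thesis by (simp add: nn_integral_std_gaussian_real_sq)
qed

text \<open>This will be the mean squared error in one column of the competitor: \<open>b\<close> is
  a fixed dual vector, \<open>K\<close> is the complement of \<open>I\<close>, and the rows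
  \<open>y $ k\<close> are still random. Coordinate \<open>i\<close> of the sum is the linear
  functional \<open>y \<bullet> a i\<close>, so the previous second moment applies to each
  coordinate.\<close>

lemma nn_integral_std_gaussian_combination:
  fixes v :: "'n::finite \<Rightarrow> real^'m" and b :: "real^'l"
  shows "(\<integral>\<^sup>+y. ennreal ((norm (\<Sum>k\<in>K. (y $ k \<bullet> b) *\<^sub>R v k))\<^sup>2) \<partial>(std_gaussian :: (real^'l^'n) measure))
    = ennreal ((norm b)\<^sup>2 * (\<Sum>k\<in>K. (norm (v k))\<^sup>2))"
proof -
  define a :: "'m \<Rightarrow> real^'l^'n" where "a i = (\<chi> k. if k \<in> K then (v k $ i) *\<^sub>R b else 0)" for i
  have nsq: "(norm x)\<^sup>2 = (\<Sum>i\<in>UNIV. (norm (x $ i))\<^sup>2)" for x :: "'b::real_normed_vector^'c::finite"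
    by (simp add: norm_vec_def L2_set_def sum_nonneg)
  have "(norm (\<Sum>k\<in>K. (y $ k \<bullet> b) *\<^sub>R v k))\<^sup>2 = (\<Sum>i\<in>UNIV. (y \<bullet> a i)\<^sup>2)" for y
  proof -
    have "y \<bullet> a i = (\<Sum>k\<in>K. (y $ k \<bullet> b) * v k $ i)" for i
    proof -
      have "y \<bullet> a i = (\<Sum>k\<in>UNIV. if k \<in> K then (y $ k \<bullet> b) * v k $ i else 0)"
        unfolding inner_vec_def[of y] a_def by (intro sum.cong) auto
      then show ?thesis by (simp add: sum.If_cases)
    qed
    then show ?thesis by (simp add: nsq)
  qed
  then have "(\<integral>\<^sup>+y. ennreal ((norm (\<Sum>k\<in>K. (y $ k \<bullet> b) *\<^sub>R v k))\<^sup>2) \<partial>(std_gaussian :: (real^'l^'n) measure))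
      = (\<integral>\<^sup>+y. (\<Sum>i\<in>UNIV. ennreal ((y \<bullet> a i)\<^sup>2)) \<partial>std_gaussian)"
    by simp
  also have "\<dots> = (\<Sum>i\<in>UNIV. \<integral>\<^sup>+y. ennreal ((y \<bullet> a i)\<^sup>2) \<partial>std_gaussian)"
    by (rule nn_integral_sum) simp
  also have "\<dots> = (\<Sum>i\<in>UNIV. ennreal ((norm (a i))\<^sup>2))"
    by (simp add: nn_integral_std_gaussian_inner_sq)
  also have "\<dots> = ennreal (\<Sum>i\<in>UNIV. (norm (a i))\<^sup>2)"
    by simp
  also have "(\<Sum>i\<in>UNIV. (norm (a i))\<^sup>2) = (\<Sum>i\<in>UNIV. \<Sum>k\<in>K. (v k $ i)\<^sup>2 * (norm b)\<^sup>2)"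
  proof (intro sum.cong refl)
    fix i
    have "(norm (a i))\<^sup>2 = (\<Sum>k\<in>UNIV. if k \<in> K then (v k $ i)\<^sup>2 * (norm b)\<^sup>2 else 0)"
      unfolding nsq[of "a i"] by (intro sum.cong) (auto simp: power_mult_distrib a_def)
    then show "(norm (a i))\<^sup>2 = (\<Sum>k\<in>K. (v k $ i)\<^sup>2 * (norm b)\<^sup>2)" by (simp add: sum.If_cases)
  qed
  also have "\<dots> = (norm b)\<^sup>2 * (\<Sum>k\<in>K. (norm (v k))\<^sup>2)"
    by (subst sum.swap) (simp add: nsq[of "v _"] sum_distrib_left mult.commute)
  finally show ?thesis .
qed

text \<open>At \<open>a = 0\<close> both sides are infinite. Hence the identity can be integrated
  without first discarding a null set.\<close>

lemma inverse_ennreal_eq_nn_integral_exp: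
  assumes "0 \<le> a"
  shows "inverse (ennreal a) = (\<integral>\<^sup>+t. ennreal (exp (- t * a / 2) / 2) * indicator {0..} t \<partial>lborel)"
proof (cases "a = 0")
  case True
  have "(\<integral>\<^sup>+t. ennreal (exp (- t * a / 2) / 2) * indicator {0..} t \<partial>lborel) = ennreal (1 / 2) * emeasure lborel {0::real..}"
    using True by (simp add: nn_integral_cmult_indicator)
  moreover have "emeasure lborel {0::real..} = \<top>"
  proof (rule ccontr)
    assume "emeasure lborel {0::real..} \<noteq> \<top>"
    then obtain r where r: "emeasure lborel {0::real..} = ennreal r" "0 \<le> r"
      by (cases "emeasure lborel {0::real..}") auto
    have "emeasure lborel {0..r + 1} \<le> emeasure lborel {0::real..}"
      by (rule emeasure_mono) auto
    then show False using r by (simp add: ennreal_le_iff2)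
  qed
  ultimately show ?thesis using True by (simp add: ennreal_mult_top)
next
  case False
  with assms have a: "a > 0" by simp
  have "(\<integral>\<^sup>+t. ennreal (exp (- t * a / 2) / 2) * indicator {0..} t \<partial>lborel) = ennreal (0 - (- exp (- 0 * a / 2) / a))"
  proof (rule nn_integral_FTC_atLeast)
    fix t :: real
    show "((\<lambda>t. - exp (- t * a / 2) / a) has_real_derivative exp (- t * a / 2) / 2) (at t)"
      using a by (auto intro!: derivative_eq_intros)
    show "((\<lambda>t. - exp (- t * a / 2) / a) \<longlongrightarrow> 0) at_top"
      using a by real_asymp
  qed auto
  then show ?thesis using a by (simp add: inverse_ennreal inverse_eq_divide)
qed

lemma inverse_ennreal_antimono:
  assumes "a \<le> (b::ennreal)"
  shows "inverse b \<le> inverse a"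
proof (cases "a = 0 \<or> b = \<top>")
  case False
  with assms obtain x y where "a = ennreal x" "b = ennreal y" "0 < x" "x \<le> y"
    by (cases a; cases b) (auto simp: less_le top_unique)
  then show ?thesis
    by (simp add: inverse_ennreal ennreal_leI le_imp_inverse_le)
qed auto

text \<open>Up to the factor \<open>1 / sqrt (1 + t)\<close>, the integrand times the normal density
  is the centred normal density of variance \<open>1 / (1 + t)\<close>, which has total mass
  1.\<close>

lemma nn_integral_std_gaussian_exp_sq:
  assumes "0 \<le> t"
  shows "(\<integral>\<^sup>+x. ennreal (exp (- t * x\<^sup>2 / 2)) \<partial>std_gaussian) = ennreal (1 / sqrt (1 + t))"
proof -
  let ?s = "1 / sqrt (1 + t)"
  have s: "?s > 0" using assms by simp
  have ss: "?s\<^sup>2 = 1 / (1 + t)" using assms by (simp add: power_divide)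
  interpret prob_space "density lborel (normal_density 0 ?s)"
    using s by (rule prob_space_normal_density)
  have "std_normal_density x * exp (- t * x\<^sup>2 / 2) = ?s * normal_density 0 ?s x" for x
  proof -
    have "- x\<^sup>2 / (2 * ?s\<^sup>2) = - x\<^sup>2 / 2 + (- t * x\<^sup>2 / 2)"
      using assms by (simp add: ss field_simps)
    moreover have "sqrt (2 * pi * ?s\<^sup>2) = sqrt (2 * pi) * ?s"
      using s by (simp add: real_sqrt_mult)
    ultimately show ?thesis
      using s by (simp add: normal_density_def exp_add[symmetric])
  qed
  then have "(\<integral>\<^sup>+x. ennreal (exp (- t * x\<^sup>2 / 2)) \<partial>std_gaussian) = (\<integral>\<^sup>+x. ennreal ?s * ennreal (normal_density 0 ?s x) \<partial>lborel)"
    unfolding std_gaussian_real using s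
    by (subst nn_integral_density) (auto simp: ennreal_mult'[symmetric])
  also have "\<dots> = ennreal ?s * emeasure (density lborel (normal_density 0 ?s)) UNIV"
    by (subst nn_integral_cmult) (auto simp: emeasure_density)
  finally show ?thesis using emeasure_space_1 by simp
qed

text \<open>Writing \<open>1 / a = 1/2 \<integral> exp (- t a / 2) dt\<close> turns the integrand into a product over the coordinates.\<close>

lemma nn_integral_inverse_chi_square:
  fixes K :: "'l::finite set"
  assumes K: "card K \<ge> 3"
  shows "(\<integral>\<^sup>+x. inverse (ennreal (\<Sum>k\<in>K. (x $ k)\<^sup>2)) \<partial>(std_gaussian :: (real^'l) measure))
    = ennreal (1 / (real (card K) - 2))"
proof -
  let ?g = "std_gaussian :: real measure" and ?G = "std_gaussian :: (real^'l) measure"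
  interpret g: prob_space ?g by (rule prob_space_std_gaussian_real)
  interpret G: prob_space ?G by (rule prob_space_std_gaussian_cart)
  interpret ps: product_sigma_finite "\<lambda>_::'l. ?g" ..
  interpret GL: pair_sigma_finite ?G "lborel :: real measure" ..
  let ?k = "real (card K)"
  have m [measurable]: "(\<lambda>x. \<chi> i. x i) \<in> borel_measurable (PiM UNIV (\<lambda>_::'l. ?g))"
    by measurable
  have prod: "(\<integral>\<^sup>+x. ennreal (exp (- t * (\<Sum>k\<in>K. (x $ k)\<^sup>2) / 2)) \<partial>?G) = ennreal ((1 + t) powr (- ?k / 2))"
    if t: "0 \<le> t" for t
  proof -
    have "exp (- t * (\<Sum>k\<in>K. (x $ k)\<^sup>2) / 2) = (\<Prod>k\<in>UNIV. if k \<in> K then exp (- t * (x $ k)\<^sup>2 / 2) else 1)" for x :: "real^'l"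
      by (simp add: prod.If_cases exp_sum[symmetric] sum_distrib_left sum_divide_distrib sum_negf)
    from this[of "vec_lambda _"] have "(\<integral>\<^sup>+x. ennreal (exp (- t * (\<Sum>k\<in>K. (x $ k)\<^sup>2) / 2)) \<partial>?G)
        = (\<integral>\<^sup>+x. (\<Prod>k\<in>UNIV. ennreal (if k \<in> K then exp (- t * (x k)\<^sup>2 / 2) else 1)) \<partial>PiM UNIV (\<lambda>_::'l. ?g))"
      unfolding std_gaussian_vec[OF prob_space_std_gaussian_real] using m
      by (subst nn_integral_distr) (auto simp: prod_ennreal cong: if_cong)
    also have "\<dots> = (\<Prod>k\<in>UNIV. \<integral>\<^sup>+x. ennreal (if k \<in> K then exp (- t * x\<^sup>2 / 2) else 1) \<partial>?g)"
      by (rule ps.product_nn_integral_prod[where f = "\<lambda>k x. ennreal (if k \<in> K then exp (- t * x\<^sup>2 / 2) else 1)"]) auto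
    also have "\<dots> = (\<Prod>k\<in>UNIV. if k \<in> K then ennreal (1 / sqrt (1 + t)) else 1)"
      using nn_integral_std_gaussian_exp_sq[OF t] g.emeasure_space_1 by (intro prod.cong) auto
    also have "\<dots> = ennreal ((1 / sqrt (1 + t)) ^ card K)"
      using t by (simp add: prod.If_cases ennreal_power)
    also have "(1 / sqrt (1 + t)) ^ card K = (1 + t) powr (- ?k / 2)"
      using t by (simp add: powr_half_sqrt[symmetric] powr_minus_divide[symmetric] powr_powr powr_realpow[symmetric])
    finally show ?thesis .
  qed
  have "(\<integral>\<^sup>+x. inverse (ennreal (\<Sum>k\<in>K. (x $ k)\<^sup>2)) \<partial>?G)
      = (\<integral>\<^sup>+x. \<integral>\<^sup>+t. ennreal (exp (- t * (\<Sum>k\<in>K. (x $ k)\<^sup>2) / 2) / 2) * indicator {0..} t \<partial>lborel \<partial>?G)"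
    by (intro nn_integral_cong inverse_ennreal_eq_nn_integral_exp sum_nonneg) auto
  also have "\<dots> = (\<integral>\<^sup>+t. \<integral>\<^sup>+x. ennreal (exp (- t * (\<Sum>k\<in>K. (x $ k)\<^sup>2) / 2) / 2) * indicator {0..} t \<partial>?G \<partial>lborel)"
    by (rule GL.Fubini'[symmetric]) simp
  also have "\<dots> = (\<integral>\<^sup>+t. ennreal ((1 + t) powr (- ?k / 2) / 2) * indicator {0..} t \<partial>lborel)"
  proof (rule nn_integral_cong)
    fix t :: real
    show "(\<integral>\<^sup>+x. ennreal (exp (- t * (\<Sum>k\<in>K. (x $ k)\<^sup>2) / 2) / 2) * indicator {0..} t \<partial>?G)
        = ennreal ((1 + t) powr (- ?k / 2) / 2) * indicator {0..} t"
    proof (cases "0 \<le> t")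
      case True
      have "(\<integral>\<^sup>+x. ennreal (exp (- t * (\<Sum>k\<in>K. (x $ k)\<^sup>2) / 2) / 2) * indicator {0..} t \<partial>?G)
          = (\<integral>\<^sup>+x. ennreal (1 / 2) * ennreal (exp (- t * (\<Sum>k\<in>K. (x $ k)\<^sup>2) / 2)) \<partial>?G)"
        using True by (intro nn_integral_cong) (simp add: ennreal_mult'[symmetric] del: ennreal_half)
      also have "\<dots> = ennreal (1 / 2) * ennreal ((1 + t) powr (- ?k / 2))"
        using prod[OF True] by (subst nn_integral_cmult) auto
      finally show ?thesis using True by (simp add: ennreal_mult'[symmetric] del: ennreal_half)
    qed simp
  qed
  \<comment> \<open>The antiderivative is \<open>- ((1 + t) powr (1 - ?k / 2)) / (?k - 2)\<close>.
    It tends to 0 at infinity because \<open>card K \<ge> 3\<close> makes the exponent negative, so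
    its value at 0 gives the result.\<close>
  also have "\<dots> = ennreal (0 - (- ((1 + 0) powr (1 - ?k / 2)) / (?k - 2)))"
  proof (rule nn_integral_FTC_atLeast)
    fix t :: real assume t: "0 \<le> t"
    have "((\<lambda>u. u powr (1 - ?k / 2)) has_real_derivative (1 - ?k / 2) * (1 + t) powr (1 - ?k / 2 - 1)) (at (1 + t))"
      using t by (intro has_real_derivative_powr) auto
    from DERIV_chain2[of "\<lambda>u. u powr (1 - ?k / 2)" _ "\<lambda>t. 1 + t" t 1, OF this]
    have "((\<lambda>t. (1 + t) powr (1 - ?k / 2)) has_real_derivative (1 - ?k / 2) * (1 + t) powr (1 - ?k / 2 - 1)) (at t)"
      using t by (auto intro!: derivative_eq_intros)
    then have "((\<lambda>t. - ((1 + t) powr (1 - ?k / 2)) / (?k - 2)) has_real_derivative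
        - ((1 - ?k / 2) * (1 + t) powr (1 - ?k / 2 - 1)) / (?k - 2)) (at t)"
      by (intro DERIV_cdivide DERIV_minus)
    also have "- ((1 - ?k / 2) * (1 + t) powr (1 - ?k / 2 - 1)) / (?k - 2) = (1 + t) powr (- ?k / 2) / 2"
      using K by (simp add: field_simps)
    finally show "((\<lambda>t. - ((1 + t) powr (1 - ?k / 2)) / (?k - 2)) has_real_derivative (1 + t) powr (- ?k / 2) / 2) (at t)" .
  next
    have "1 - ?k / 2 < 0" using K by simp
    then show "((\<lambda>t. - ((1 + t) powr (1 - ?k / 2)) / (?k - 2)) \<longlongrightarrow> 0) at_top"
      by real_asymp
  qed auto
  finally show ?thesis by simp
qed

text \<open>Orthonormal bases of \<open>S\<close> and of its orthogonal complement together form a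
  basis with as many vectors as there are coordinates; \<open>f\<close> sends the coordinate vectors
  to it. Leaving \<open>d\<close> free covers both a subspace of known dimension and a row space
  whose dimension may be smaller than the target rank.\<close>

lemma adapted_orthogonal_transformation:
  fixes S :: "(real^'k) set"
  assumes S: "subspace S" and d: "dim S \<le> d" "d \<le> CARD('k)"
  obtains f :: "real^'k \<Rightarrow> real^'k" and I where "orthogonal_transformation f" "card I = d"
    "\<And>k s. k \<notin> I \<Longrightarrow> s \<in> S \<Longrightarrow> f (axis k 1) \<bullet> s = 0"
proof -
  obtain B where B: "B \<subseteq> S" "pairwise orthogonal B" "\<And>x. x \<in> B \<Longrightarrow> norm x = 1"
    "independent B" "card B = dim S" "span B = S"
    using orthonormal_basis_subspace[OF S] by metis
  define T where "T = {y. \<forall>x\<in>S. orthogonal x y}"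
  have T: "subspace T" unfolding T_def by (rule subspace_orthogonal_to_vectors)
  obtain C where C: "C \<subseteq> T" "pairwise orthogonal C" "\<And>x. x \<in> C \<Longrightarrow> norm x = 1"
    "independent C" "card C = dim T" "span C = T"
    using orthonormal_basis_subspace[OF T] by metis
  have dimT: "dim S + dim T = CARD('k)"
    using dim_subspace_orthogonal_to_vectors[OF S subspace_UNIV subset_UNIV]
    by (simp add: T_def add.commute orthogonal_commute)
  have fin: "finite B" "finite C"
    using B(4) C(4) by (auto simp: independent_imp_finite)
  have disj: "B \<inter> C = {}"
  proof (rule ccontr)
    assume "B \<inter> C \<noteq> {}"
    then obtain x where "x \<in> B" "x \<in> C" by blast
    then have "orthogonal x x" using B(1) C(1) by (auto simp: T_def)
    then show False using B(3)[OF \<open>x \<in> B\<close>] by (simp add: orthogonal_self)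
  qed
  have card: "card (B \<union> C) = CARD('k)"
    using fin disj B(5) C(5) dimT by (simp add: card_Un_disjoint)
  then obtain \<beta> :: "'k \<Rightarrow> real^'k" where \<beta>: "bij_betw \<beta> UNIV (B \<union> C)"
    using finite_same_card_bij[of "UNIV :: 'k set" "B \<union> C"] fin by auto
  have inj: "inj \<beta>" and ran: "range \<beta> = B \<union> C" using \<beta> by (auto simp: bij_betw_def)
  have orth: "\<beta> i \<bullet> \<beta> j = (if i = j then 1 else 0)" for i j
  proof (cases "i = j")
    case True
    then show ?thesis using B(3) C(3) ran by (metis UnE norm_eq_1 rangeI)
  next
    case False
    then have "\<beta> i \<noteq> \<beta> j" using inj by (auto dest: injD)
    moreover have "\<beta> i \<in> B \<union> C" "\<beta> j \<in> B \<union> C" using ran by auto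
    ultimately have "orthogonal (\<beta> i) (\<beta> j)"
      using B(1,2) C(1,2) unfolding T_def pairwise_def by (blast intro: orthogonal_commute[THEN iffD1])
    then show ?thesis using False by (simp add: orthogonal_def)
  qed
  define f where "f x = (\<Sum>k\<in>UNIV. (x $ k) *\<^sub>R \<beta> k)" for x
  have f: "orthogonal_transformation f"
    unfolding orthogonal_transformation_def
  proof
    show "linear f"
      by (rule linearI) (simp_all add: f_def scaleR_add_left sum.distrib scaleR_sum_right)
    show "\<forall>v w. f v \<bullet> f w = v \<bullet> w"
    proof (intro allI)
      fix v w
      have "f v \<bullet> f w = (\<Sum>j\<in>UNIV. \<Sum>i\<in>UNIV. v $ i * (w $ j * (\<beta> i \<bullet> \<beta> j)))"
        by (simp only: f_def inner_sum_left inner_sum_right inner_scaleR_left inner_scaleR_right)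
          (simp add: sum_distrib_left mult.left_commute)
      also have "\<dots> = (\<Sum>i\<in>UNIV. \<Sum>j\<in>UNIV. v $ i * (w $ j * (\<beta> i \<bullet> \<beta> j)))"
        by (rule sum.swap)
      also have "\<dots> = (\<Sum>i\<in>UNIV. v $ i * w $ i)"
        by (simp add: orth if_distrib[of "\<lambda>x. _ * x"] cong: if_cong)
      finally show "f v \<bullet> f w = v \<bullet> w" by (simp add: inner_vec_def)
    qed
  qed
  have fax: "f (axis k 1) = \<beta> k" for k
    by (simp add: f_def axis_def if_distrib[of "\<lambda>x. x *\<^sub>R _"] cong: if_cong)
  \<comment> \<open>\<open>I0\<close> indexes the basis of \<open>S\<close> and may have fewer than
    \<open>d\<close> elements. Padding it is harmless, since the claim concerns only indices outside
    \<open>I\<close>.\<close>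
  define I0 where "I0 = {k. \<beta> k \<in> B}"
  have "\<beta> ` I0 = B" using ran by (auto simp: I0_def)
  then have "card I0 = dim S" using B(5) card_image[of \<beta> I0] inj by (metis inj_on_subset subset_UNIV)
  then obtain I where I: "I0 \<subseteq> I" "card I = d"
    using exists_subset_between[of I0 d UNIV] d by auto
  show ?thesis
  proof (rule that[OF f I(2)])
    fix k s assume "k \<notin> I" "s \<in> S"
    then have "\<beta> k \<in> C" using I ran by (auto simp: I0_def)
    then show "f (axis k 1) \<bullet> s = 0"
      using C(1) \<open>s \<in> S\<close> by (auto simp: T_def fax orthogonal_def inner_commute)
  qed
qed

text \<open>After rotating \<open>S\<close> into the coordinate subspace of \<open>I\<close>, the
  coordinates outside \<open>I\<close> cannot be reduced by subtracting a point of the subspace. The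
  squared distance thus dominates a sum of \<open>CARD('l) - dim S\<close> squared normal
  coordinates, whose mean inverse is known.\<close>

lemma nn_integral_inverse_infdist_sq:
  fixes S :: "(real^'l) set"
  assumes S: "subspace S" and d: "dim S + 3 \<le> CARD('l)"
  shows "(\<integral>\<^sup>+x. inverse (ennreal ((infdist x S)\<^sup>2)) \<partial>std_gaussian) \<le> ennreal (1 / (real CARD('l) - real (dim S) - 2))"
proof -
  obtain f :: "real^'l \<Rightarrow> real^'l" and I where f: "orthogonal_transformation f" and I: "card I = dim S"
    and perp: "\<And>k s. k \<notin> I \<Longrightarrow> s \<in> S \<Longrightarrow> f (axis k 1) \<bullet> s = 0"
    using adapted_orthogonal_transformation[OF S, of "dim S"] d by auto
  have [measurable]: "f \<in> borel_measurable borel"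
    using f by (intro borel_measurable_continuous_onI linear_continuous_on)
      (auto simp: orthogonal_transformation_def linear_conv_bounded_linear)
  have cI: "card (- I) = CARD('l) - dim S"
    using I by (simp add: Compl_eq_Diff_UNIV card_Diff_subset)
  have ne: "S \<noteq> {}" using subspace_0[OF S] by auto
  have le: "(\<Sum>k\<in>- I. (x $ k)\<^sup>2) \<le> (infdist (f x) S)\<^sup>2" for x
  proof -
    have "sqrt (\<Sum>k\<in>- I. (x $ k)\<^sup>2) \<le> infdist (f x) S"
      unfolding infdist_notempty[OF ne]
    proof (rule cINF_greatest)
      show "S \<noteq> {}" by (rule ne)
      fix s assume s: "s \<in> S"
      obtain z where z: "f z = s" using orthogonal_transformation_surj[OF f] by (metis surjD)
      have "z $ k = 0" if "k \<notin> I" for k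
      proof -
        have "z $ k = axis k 1 \<bullet> z" by (simp add: inner_axis')
        also have "\<dots> = f (axis k 1) \<bullet> f z" using f by (simp add: orthogonal_transformation_def)
        finally show ?thesis using perp[OF that s] z by simp
      qed
      then have "(\<Sum>k\<in>- I. (x $ k)\<^sup>2) = (\<Sum>k\<in>- I. ((x - z) $ k)\<^sup>2)" by simp
      also have "\<dots> \<le> (\<Sum>k\<in>UNIV. ((x - z) $ k)\<^sup>2)" by (rule sum_mono2) auto
      finally have "sqrt (\<Sum>k\<in>- I. (x $ k)\<^sup>2) \<le> norm (x - z)"
        by (simp add: norm_vec_def L2_set_def)
      also have "\<dots> = dist (f x) s"
        using f z by (auto simp: dist_norm orthogonal_transformation linear_diff[symmetric])
      finally show "sqrt (\<Sum>k\<in>- I. (x $ k)\<^sup>2) \<le> dist (f x) s" .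
    qed
    then show ?thesis by (rule sqrt_le_D)
  qed
  have [measurable]: "(\<lambda>x. infdist x S) \<in> borel_measurable borel"
    by (intro borel_measurable_continuous_onI continuous_intros)
  have "(\<integral>\<^sup>+x. inverse (ennreal ((infdist x S)\<^sup>2)) \<partial>std_gaussian)
      = (\<integral>\<^sup>+x. inverse (ennreal ((infdist (f x) S)\<^sup>2)) \<partial>std_gaussian)"
    by (subst std_gaussian_distr_isometry[OF f, symmetric], subst nn_integral_distr) auto
  also have "\<dots> \<le> (\<integral>\<^sup>+x. inverse (ennreal (\<Sum>k\<in>- I. (x $ k)\<^sup>2)) \<partial>(std_gaussian :: (real^'l) measure))"
    by (intro nn_integral_mono inverse_ennreal_antimono ennreal_leI le)
  also have "\<dots> = ennreal (1 / (real (card (- I)) - 2))"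
    by (rule nn_integral_inverse_chi_square) (use d cI in simp)
  finally show ?thesis using cI d by (simp add: of_nat_diff)
qed

section \<open>Near-optimality of the randomized truncated SVD\<close>

lemma norm_sq_columns:
  fixes X :: "real^'n^'m"
  shows "(norm X)\<^sup>2 = (\<Sum>j\<in>UNIV. (norm (column j X))\<^sup>2)"
proof -
  have "(norm X)\<^sup>2 = (\<Sum>i\<in>UNIV. \<Sum>j\<in>UNIV. (X $ i $ j)\<^sup>2)"
    by (simp add: norm_vec_def L2_set_def sum_nonneg)
  also have "\<dots> = (\<Sum>j\<in>UNIV. \<Sum>i\<in>UNIV. (X $ i $ j)\<^sup>2)" by (rule sum.swap)
  also have "\<dots> = (\<Sum>j\<in>UNIV. (norm (column j X))\<^sup>2)"
    by (simp add: norm_vec_def L2_set_def sum_nonneg column_def)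
  finally show ?thesis .
qed

lemma column_diff: "column j (X - Y) = column j X - column j (Y :: real^'n^'m)"
  by (simp add: column_def vec_eq_iff)

lemma column_compress:
  "column j (compress B Y) = (\<Sum>q\<in>B. (column j Y \<bullet> q) *\<^sub>R q)"
  by (simp add: vec_eq_iff column_def compress_def vector_matrix_mult_def inner_vec_def mult.commute)

lemma orthonormal_projection_orthogonal:
  fixes B :: "'a::euclidean_space set"
  assumes B: "pairwise orthogonal B" "\<forall>q\<in>B. norm q = 1" and w: "w \<in> span B"
  shows "(x - (\<Sum>q\<in>B. (x \<bullet> q) *\<^sub>R q)) \<bullet> w = 0"
proof -
  have fin: "finite B" using B(1) by (rule pairwise_orthogonal_imp_finite)
  have "orthogonal (x - (\<Sum>q\<in>B. (x \<bullet> q) *\<^sub>R q)) w"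
    using w
  proof (rule orthogonal_to_span)
    fix p assume p: "p \<in> B"
    have "(\<Sum>q\<in>B. (x \<bullet> q) * (q \<bullet> p)) = (\<Sum>q\<in>B. if q = p then x \<bullet> p else 0)"
      using B p by (intro sum.cong) (auto simp: pairwise_def orthogonal_def norm_eq_1)
    then show "orthogonal (x - (\<Sum>q\<in>B. (x \<bullet> q) *\<^sub>R q)) p"
      using fin p by (simp add: orthogonal_def inner_diff_left inner_sum_left)
  qed
  then show ?thesis by (simp add: orthogonal_def)
qed

text \<open>Compression projects each column orthogonally onto \<open>S\<close>, and the squared
  Frobenius norm is the sum over columns.\<close>

lemma compress_pythagoras:
  fixes Y U :: "real^'n^'m"
  assumes B: "orthonormal_basis_of S B" and U: "\<And>j. column j U \<in> S"
  shows "(norm (Y - U))\<^sup>2 = (norm (Y - compress B Y))\<^sup>2 + (norm (compress B Y - U))\<^sup>2"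
proof -
  have B': "pairwise orthogonal B" "\<forall>q\<in>B. norm q = 1" "span B = S"
    using B by (auto simp: orthonormal_basis_of_def)
  have "(norm (column j (Y - U)))\<^sup>2
      = (norm (column j (Y - compress B Y)))\<^sup>2 + (norm (column j (compress B Y - U)))\<^sup>2" for j
  proof -
    let ?p = "\<Sum>q\<in>B. (column j Y \<bullet> q) *\<^sub>R q"
    have "?p - column j U \<in> span B"
      using U B' by (intro span_diff span_sum span_scale) (auto intro: span_base)
    from orthonormal_projection_orthogonal[OF B'(1,2) this]
    have "orthogonal (column j Y - ?p) (?p - column j U)" by (simp add: orthogonal_def)
    from norm_add_Pythagorean[OF this] show ?thesis
      by (simp add: column_diff column_compress)
  qed
  then show ?thesis by (simp add: norm_sq_columns sum.distrib)
qed

lemma column_compress_in: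
  assumes "orthonormal_basis_of S B"
  shows "column j (compress B Y) \<in> S"
  using assms unfolding column_compress orthonormal_basis_of_def
  by (auto intro!: span_sum span_scale intro: span_base)

lemma rank_compress_le:
  fixes Y :: "real^'n^'m"
  shows "rank (compress B Y) \<le> rank Y"
proof -
  have "compress B Y $ i $ j = ((\<chi> i j. \<Sum>q\<in>B. q $ i * q $ j) ** Y) $ i $ j" for i j
  proof -
    have "compress B Y $ i $ j = (\<Sum>q\<in>B. \<Sum>k\<in>UNIV. q $ i * q $ k * Y $ k $ j)"
      by (simp add: compress_def vector_matrix_mult_def sum_distrib_left mult.assoc mult.commute[of "Y $ _ $ _"])
    also have "\<dots> = (\<Sum>k\<in>UNIV. \<Sum>q\<in>B. q $ i * q $ k * Y $ k $ j)"
      by (rule sum.swap)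
    finally show ?thesis by (simp add: matrix_matrix_mult_def sum_distrib_right)
  qed
  then have "compress B Y = (\<chi> i j. \<Sum>q\<in>B. q $ i * q $ j) ** Y"
    by (simp add: vec_eq_iff)
  then show ?thesis by (simp add: rank_mul_le_right)
qed

text \<open>Truncation costs nothing here: the output is nearest to \<open>V\<close> among all matrices of rank at most
  \<open>r\<close> whose columns lie in the sampled range.\<close>

lemma rsvd_output_optimal:
  fixes V Z W :: "real^'n^'m"
  assumes Z: "rsvd_output r V \<Omega> Z" and W: "rank W \<le> r" "\<And>j. column j W \<in> range ((*v) (V ** \<Omega>))"
  shows "norm (V - Z) \<le> norm (V - W)"
proof -
  obtain B where B: "orthonormal_basis_of (range ((*v) (V ** \<Omega>))) B"
    and p: "rank Z \<le> r" "\<And>U. rank U \<le> r \<Longrightarrow> norm (compress B V - Z) \<le> norm (compress B V - U)"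
    using Z by (auto simp: rsvd_output_def is_projection_def low_rank_def dist_norm)
  note pyth = compress_pythagoras[OF B]
  \<comment> \<open>The output lies in the sampled range itself: compressing \<open>Z\<close> does
    not raise its rank, and by Pythagoras it would come strictly closer to
    \<open>compress B V\<close> unless \<open>Z\<close> is already compressed.\<close>
  have "norm (compress B V - Z) \<le> norm (compress B V - compress B Z)"
    using p rank_compress_le[of B Z] by (meson order_trans)
  moreover have "(norm (Z - compress B V))\<^sup>2 = (norm (Z - compress B Z))\<^sup>2 + (norm (compress B Z - compress B V))\<^sup>2"
    by (rule pyth) (rule column_compress_in[OF B])
  ultimately have "(norm (Z - compress B Z))\<^sup>2 \<le> 0"
    using power_mono[of "norm (compress B V - Z)" "norm (compress B V - compress B Z)" 2]
    by (simp add: norm_minus_commute)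
  then have "Z = compress B Z" by simp
  \<comment> \<open>The part of \<open>V\<close> orthogonal to the sampled range now contributes the
    same amount to the errors of \<open>Z\<close> and \<open>W\<close>, so optimality for the
    compressed matrix carries over to \<open>V\<close>.\<close>
  then have "column j Z \<in> range ((*v) (V ** \<Omega>))" for j
    using column_compress_in[OF B, of j Z] by simp
  then have "(norm (V - Z))\<^sup>2 = (norm (V - compress B V))\<^sup>2 + (norm (compress B V - Z))\<^sup>2"
    by (rule pyth)
  also have "\<dots> \<le> (norm (V - compress B V))\<^sup>2 + (norm (compress B V - W))\<^sup>2"
    by (intro add_left_mono power_mono p(2) W) auto
  also have "\<dots> = (norm (V - W))\<^sup>2"
    by (rule pyth[symmetric]) (rule W(2))
  finally show ?thesis by (rule power2_le_imp_le) simp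
qed

text \<open>The competitor is the zero matrix. The bound holds for every draw and later provides
  integrability.\<close>

lemma rsvd_output_norm_le:
  assumes "rsvd_output r V \<Omega> Z"
  shows "norm (V - Z) \<le> norm V"
proof -
  show ?thesis
    using rsvd_output_optimal[OF assms, of 0]
    by (simp add: column_def zero_vec_def[symmetric] range_eqI[of _ _ 0])
qed

lemma norm_matrix_mul_transpose_orthogonal:
  fixes X :: "real^'n^'m" and f :: "real^'n \<Rightarrow> real^'n"
  assumes f: "orthogonal_transformation f"
  shows "norm (X ** transpose (matrix f)) = norm X"
proof -
  have lin: "linear f" and nrm: "\<And>x. norm (f x) = norm x"
    using f by (auto simp: orthogonal_transformation)
  have "(X ** transpose (matrix f)) $ i = matrix f *v (X $ i)" for i
    by (simp add: vec_eq_iff matrix_matrix_mult_def matrix_vector_mult_def transpose_def mult.commute)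
  also have "matrix f *v (X $ i) = f (X $ i)" for i
    using matrix_vector_mul(2)[OF lin] by metis
  finally have rows: "(X ** transpose (matrix f)) $ i = f (X $ i)" for i .
  have "norm Y = L2_set (\<lambda>i. norm (Y $ i)) UNIV" for Y :: "real^'n^'m"
    by (rule norm_vec_def)
  then show ?thesis by (simp only: rows nrm)
qed

text \<open>The competitor of rank \<open>r\<close> is \<open>V \<Omega> \<Omega>\<^sub>1\<^sup>\<dagger> H\<^sup>T\<close>, where \<open>\<Omega>\<^sub>1\<close> consists of the rows \<open>I\<close> of \<open>\<Omega>\<close>; the
  vectors \<open>b j\<close> are the columns of the right inverse \<open>\<Omega>\<^sub>1\<^sup>\<dagger>\<close>.\<close>

lemma rsvd_output_error:
  fixes V Z :: "real^'n^'m" and \<Omega> :: "real^'l^'n" and b :: "'n \<Rightarrow> real^'l" and f :: "real^'n \<Rightarrow> real^'n"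
  assumes f: "orthogonal_transformation f" and I: "card I \<le> r"
    and b: "\<And>i j. i \<in> I \<Longrightarrow> j \<in> I \<Longrightarrow> \<Omega> $ i \<bullet> b j = (if i = j then 1 else 0)"
    and Z: "rsvd_output r V (matrix f ** \<Omega>) Z"
  shows "(norm (V - Z))\<^sup>2 \<le> (\<Sum>k\<in>- I. (norm (V *v f (axis k 1)))\<^sup>2)
    + (\<Sum>j\<in>I. (norm (\<Sum>k\<in>- I. (\<Omega> $ k \<bullet> b j) *\<^sub>R (V *v f (axis k 1))))\<^sup>2)"
proof -
  let ?F = "matrix f"
  define v where "v k = V *v f (axis k 1)" for k
  have lin: "linear f" using f by (simp add: orthogonal_transformation_def)
  have F: "?F *v x = f x" for x using matrix_vector_mul(2)[OF lin] by metis
  have colF: "column k (V ** ?F) = v k" for k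
    by (simp add: matrix_vector_mult_basis[symmetric] matrix_vector_mul_assoc[symmetric] F v_def)
  \<comment> \<open>This is the competitor in rotated coordinates. It has at most
    \<open>card I\<close> nonzero columns, which bounds its rank, and each of them lies in the
    sampled range.\<close>
  define W' :: "real^'n^'m" where "W' = (\<chi> i j. if j \<in> I then (V ** ?F ** \<Omega> *v b j) $ i else 0)"
  have colW': "column j W' = (if j \<in> I then V ** ?F ** \<Omega> *v b j else 0)" for j
    by (simp add: W'_def column_def vec_eq_iff)
  define W where "W = W' ** transpose ?F"
  have expand: "V ** ?F ** \<Omega> *v x = (\<Sum>k\<in>UNIV. (\<Omega> $ k \<bullet> x) *\<^sub>R v k)" for x
  proof -
    have "V ** ?F ** \<Omega> *v x = (V ** ?F) *v (\<Omega> *v x)" by (simp add: matrix_vector_mul_assoc)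
    also have "\<dots> = (\<Sum>k\<in>UNIV. ((\<Omega> *v x) $ k) *\<^sub>R v k)"
      by (simp add: matrix_mult_sum colF scalar_mult_eq_scaleR)
    finally show ?thesis by (simp add: matrix_vector_mul_component)
  qed
  have "columns W' \<subseteq> span ((\<lambda>j. V ** ?F ** \<Omega> *v b j) ` I)"
    by (auto simp: columns_def colW' span_base span_0)
  then have "rank W' \<le> card ((\<lambda>j. V ** ?F ** \<Omega> *v b j) ` I)"
    unfolding column_rank_def by (rule dim_le_card) simp
  also have "\<dots> \<le> r" using I card_image_le[of I] by (meson finite order_trans)
  finally have "rank W' \<le> r" .
  then have rW: "rank W \<le> r"
    unfolding W_def using rank_mul_le_left[of W' "transpose ?F"] by simp
  \<comment> \<open>Rotating back only forms linear combinations of the columns of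
    \<open>W'\<close>, so it does not leave the sampled range.\<close>
  have cW: "column j W \<in> range ((*v) (V ** (?F ** \<Omega>)))" for j
  proof -
    have sub: "subspace (range ((*v) (V ** (?F ** \<Omega>))))"
      by (intro linear_subspace_image matrix_vector_mul_linear subspace_UNIV)
    have "column j W = (\<Sum>k\<in>UNIV. (column j (transpose ?F) $ k) *\<^sub>R column k W')"
      unfolding W_def
      unfolding scalar_mult_eq_scaleR[symmetric] matrix_mult_sum[symmetric]
      by (simp only: matrix_vector_mult_basis[symmetric] matrix_vector_mul_assoc)
    also have "\<dots> \<in> range ((*v) (V ** (?F ** \<Omega>)))"
      by (intro subspace_sum[OF sub] subspace_scale[OF sub])
        (auto simp: colW' matrix_mul_assoc subspace_0[OF sub, unfolded matrix_mul_assoc])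
    finally show ?thesis .
  qed
  have FF: "?F ** transpose ?F = mat 1"
    using f orthogonal_transformation_matrix[of f]
    by (simp add: orthogonal_matrix_def)
  have sub: "(A - B) ** C = A ** C - B ** C" for A B :: "real^'n^'m" and C :: "real^'n^'n"
    by (simp add: vec_eq_iff matrix_matrix_mult_def left_diff_distrib sum_subtractf)
  have "V - W = (V ** ?F - W') ** transpose ?F"
    by (simp add: W_def sub matrix_mul_assoc[symmetric] FF)
  then have "(norm (V - W))\<^sup>2 = (norm (V ** ?F - W'))\<^sup>2"
    by (simp add: norm_matrix_mul_transpose_orthogonal[OF f])
  also have "\<dots> = (\<Sum>j\<in>UNIV. (norm (v j - column j W'))\<^sup>2)"
    by (simp add: norm_sq_columns column_diff colF)
  \<comment> \<open>For \<open>j\<close> in \<open>I\<close>, duality of the \<open>b j\<close>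
    reproduces \<open>v j\<close> exactly and leaves only the contamination from rows outside
    \<open>I\<close>. For the other \<open>j\<close> the column of the competitor is 0 and all of
    \<open>v j\<close> is error.\<close>
  also have "\<dots> = (\<Sum>j\<in>UNIV. if j \<in> I then (norm (\<Sum>k\<in>- I. (\<Omega> $ k \<bullet> b j) *\<^sub>R v k))\<^sup>2 else (norm (v j))\<^sup>2)"
  proof (intro sum.cong refl)
    fix j
    show "(norm (v j - column j W'))\<^sup>2
      = (if j \<in> I then (norm (\<Sum>k\<in>- I. (\<Omega> $ k \<bullet> b j) *\<^sub>R v k))\<^sup>2 else (norm (v j))\<^sup>2)"
    proof (cases "j \<in> I")
      case True
      have "(\<Sum>k\<in>UNIV. (\<Omega> $ k \<bullet> b j) *\<^sub>R v k)
          = (\<Sum>k\<in>- I. (\<Omega> $ k \<bullet> b j) *\<^sub>R v k) + (\<Sum>k\<in>I. (\<Omega> $ k \<bullet> b j) *\<^sub>R v k)"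
        using sum.subset_diff[of I UNIV] by (simp add: Compl_eq_Diff_UNIV)
      also have "(\<Sum>k\<in>I. (\<Omega> $ k \<bullet> b j) *\<^sub>R v k) = (\<Sum>k\<in>I. if k = j then v j else 0)"
        using b True by (intro sum.cong) auto
      also have "\<dots> = v j" using True by simp
      finally show ?thesis using True by (simp add: colW' expand)
    qed (simp add: colW')
  qed
  also have "\<dots> = (\<Sum>j\<in>I. (norm (\<Sum>k\<in>- I. (\<Omega> $ k \<bullet> b j) *\<^sub>R v k))\<^sup>2) + (\<Sum>k\<in>- I. (norm (v k))\<^sup>2)"
    by (simp add: sum.If_cases)
  finally have "(norm (V - W))\<^sup>2 = \<dots>" .
  moreover have "(norm (V - Z))\<^sup>2 \<le> (norm (V - W))\<^sup>2"
    by (intro power_mono rsvd_output_optimal[OF Z rW cW]) simp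
  ultimately show ?thesis by (simp add: v_def add.commute)
qed

section \<open>Expected error of the randomized projector\<close>

lemma span_image_finite:
  assumes "finite J"
  shows "span (g ` J) = range (\<lambda>c. \<Sum>i\<in>J. c i *\<^sub>R g i)"
proof
  have "subspace (range (\<lambda>c. \<Sum>i\<in>J. c i *\<^sub>R g i))"
  proof (rule subspaceI)
    show "0 \<in> range (\<lambda>c. \<Sum>i\<in>J. c i *\<^sub>R g i)"
      by (rule range_eqI[of _ _ "\<lambda>_. 0"]) simp
    show "x + y \<in> range (\<lambda>c. \<Sum>i\<in>J. c i *\<^sub>R g i)"
      if xy: "x \<in> range (\<lambda>c. \<Sum>i\<in>J. c i *\<^sub>R g i)" "y \<in> range (\<lambda>c. \<Sum>i\<in>J. c i *\<^sub>R g i)" for x y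
    proof -
      obtain c d where "x = (\<Sum>i\<in>J. c i *\<^sub>R g i)" "y = (\<Sum>i\<in>J. d i *\<^sub>R g i)"
        using xy by blast
      then show ?thesis
        by (intro range_eqI[of _ _ "\<lambda>i. c i + d i"]) (simp add: scaleR_add_left sum.distrib)
    qed
    show "a *\<^sub>R x \<in> range (\<lambda>c. \<Sum>i\<in>J. c i *\<^sub>R g i)"
      if x: "x \<in> range (\<lambda>c. \<Sum>i\<in>J. c i *\<^sub>R g i)" for a x
    proof -
      obtain c where "x = (\<Sum>i\<in>J. c i *\<^sub>R g i)" using x by blast
      then show ?thesis
        by (intro range_eqI[of _ _ "\<lambda>i. a * c i"]) (simp add: scaleR_sum_right)
    qed
  qed
  moreover have "g ` J \<subseteq> range (\<lambda>c. \<Sum>i\<in>J. c i *\<^sub>R g i)"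
  proof
    fix y assume "y \<in> g ` J"
    then obtain j where j: "j \<in> J" "y = g j" by blast
    have "(\<Sum>i\<in>J. (if i = j then 1 else 0) *\<^sub>R g i) = (\<Sum>i\<in>J. if i = j then g j else 0)"
      by (intro sum.cong) auto
    then show "y \<in> range (\<lambda>c. \<Sum>i\<in>J. c i *\<^sub>R g i)"
      using assms j by (intro range_eqI[of _ _ "\<lambda>i. if i = j then 1 else 0"]) simp
  qed
  ultimately show "span (g ` J) \<subseteq> range (\<lambda>c. \<Sum>i\<in>J. c i *\<^sub>R g i)" by (rule span_minimal[rotated])
  show "range (\<lambda>c. \<Sum>i\<in>J. c i *\<^sub>R g i) \<subseteq> span (g ` J)"
    by (auto intro!: span_sum span_scale intro: span_base)
qed

text \<open>For fixed coefficients the distance to the combination is continuous in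
  \<open>x\<close>, so a strict sublevel set of the infimum is a union of open sets. The union is
  uncountable, but it is still open, hence Borel.\<close>

lemma measurable_infdist_span_rows [measurable]:
  fixes J :: "'n::finite set"
  shows "(\<lambda>x::real^'l^'n. infdist (x $ j) (span ((\<lambda>i. x $ i) ` J))) \<in> borel_measurable borel"
  unfolding borel_measurable_iff_less
proof
  fix a
  have "{x::real^'l^'n. infdist (x $ j) (span ((\<lambda>i. x $ i) ` J)) < a}
      = (\<Union>c. {x. norm (x $ j - (\<Sum>i\<in>J. c i *\<^sub>R x $ i)) < a})"
  proof -
    have "infdist (x $ j) (span ((\<lambda>i. x $ i) ` J)) < a \<longleftrightarrow> (\<exists>c. norm (x $ j - (\<Sum>i\<in>J. c i *\<^sub>R x $ i)) < a)"
      for x :: "real^'l^'n"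
    proof -
      have "bdd_below (range (\<lambda>c. dist (x $ j) (\<Sum>i\<in>J. c i *\<^sub>R x $ i)))"
        by (rule bdd_belowI2[of _ 0]) simp
      then show ?thesis
        by (subst infdist_notempty) (auto simp: span_image_finite image_image cINF_less_iff dist_norm)
    qed
    then show ?thesis by blast
  qed
  moreover have "open {x::real^'l^'n. norm (x $ j - (\<Sum>i\<in>J. c i *\<^sub>R x $ i)) < a}" for c
    by (intro open_Collect_less continuous_intros)
  ultimately have "open {x::real^'l^'n. infdist (x $ j) (span ((\<lambda>i. x $ i) ` J)) < a}"
    by auto
  then show "{x \<in> space borel. infdist (x $ j) (span ((\<lambda>i. x $ i) ` J)) < a} \<in> sets (borel :: (real^'l^'n) measure)"
    by simp
qed

text \<open>With \<open>z\<close> the component of \<open>x\<close> orthogonal to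
  \<open>span T\<close>, the vector is \<open>z / (z \<bullet> z)\<close>. Applied to one of several
  independent rows and the span of the others, it is the corresponding column of the pseudoinverse,
  and \<open>norm z\<close> is the distance.\<close>

lemma dual_vector_exists:
  fixes x :: "'a::euclidean_space"
  assumes "infdist x (span T) \<noteq> 0"
  obtains b where "(norm b)\<^sup>2 = 1 / (infdist x (span T))\<^sup>2" "x \<bullet> b = 1" "\<And>t. t \<in> T \<Longrightarrow> t \<bullet> b = 0"
proof -
  obtain y z where yz: "y \<in> span T" "\<And>w. w \<in> span T \<Longrightarrow> orthogonal z w" "x = y + z"
    using orthogonal_subspace_decomp_exists[of T x] by metis
  have "infdist x (span T) = norm z"
  proof (rule antisym)
    show "infdist x (span T) \<le> norm z"
      using infdist_le[OF yz(1), of x] by (simp add: yz(3) dist_norm)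
    show "norm z \<le> infdist x (span T)"
      unfolding infdist_notempty[OF ex_in_conv[THEN iffD1, OF exI, OF yz(1)]]
    proof (rule cINF_greatest)
      fix w assume "w \<in> span T"
      then have "orthogonal z (y - w)" using yz by (intro yz(2) span_diff)
      then have "(norm (z + (y - w)))\<^sup>2 = (norm z)\<^sup>2 + (norm (y - w))\<^sup>2"
        by (rule norm_add_Pythagorean)
      then have "(norm z)\<^sup>2 \<le> (norm (z + (y - w)))\<^sup>2" by simp
      then have "norm z \<le> norm (z + (y - w))" by (rule power2_le_imp_le) simp
      then show "norm z \<le> dist x w" by (simp add: yz(3) dist_norm algebra_simps)
    qed (use yz(1) in auto)
  qed
  note nz = this
  have z: "z \<bullet> z \<noteq> 0" using assms nz by simp
  show ?thesis
  proof (rule that[of "(1 / (z \<bullet> z)) *\<^sub>R z"])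
    show "(norm ((1 / (z \<bullet> z)) *\<^sub>R z))\<^sup>2 = 1 / (infdist x (span T))\<^sup>2"
      using z by (simp add: nz power_mult_distrib power_divide dot_square_norm power2_eq_square)
    have "y \<bullet> z = 0" using yz(1,2) by (simp add: orthogonal_def inner_commute)
    then show "x \<bullet> ((1 / (z \<bullet> z)) *\<^sub>R z) = 1" using z by (simp add: yz(3) inner_add_left)
    show "t \<bullet> ((1 / (z \<bullet> z)) *\<^sub>R z) = 0" if "t \<in> T" for t
      using yz(2)[OF span_base[OF that]] by (simp add: orthogonal_def inner_commute)
  qed
qed

text \<open>With all rows except \<open>j\<close> held fixed, the span is a fixed subspace while row
  \<open>j\<close> is still standard Gaussian. Dependent rows only lower the dimension of the span,
  which improves the bound.\<close>

lemma nn_integral_inverse_infdist_rows: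
  fixes J :: "'n::finite set"
  assumes J: "j \<notin> J" and c: "card J + 3 \<le> CARD('l)"
  shows "(\<integral>\<^sup>+x. inverse (ennreal ((infdist (x $ j) (span ((\<lambda>i. x $ i) ` J)))\<^sup>2)) \<partial>(std_gaussian :: (real^'l^'n) measure))
    \<le> ennreal (1 / (real CARD('l) - real (card J) - 2))"
proof -
  interpret G: prob_space "std_gaussian :: (real^'l^'n) measure"
    by (rule prob_space_std_gaussian_rows)
  let ?F = "\<lambda>x::real^'l^'n. inverse (ennreal ((infdist (x $ j) (span ((\<lambda>i. x $ i) ` J)))\<^sup>2))"
  have "(\<integral>\<^sup>+x. ?F x \<partial>std_gaussian)
      = (\<integral>\<^sup>+x. \<integral>\<^sup>+y. ?F (\<chi> i. if i \<in> - {j} then x $ i else y $ i) \<partial>std_gaussian \<partial>std_gaussian)"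
    by (rule std_gaussian_resample[OF prob_space_std_gaussian_cart]) measurable
  also have "\<dots> \<le> (\<integral>\<^sup>+(x::real^'l^'n). ennreal (1 / (real CARD('l) - real (card J) - 2)) \<partial>std_gaussian)"
  proof (rule nn_integral_mono)
    fix x :: "real^'l^'n"
    let ?S = "span ((\<lambda>i. x $ i) ` J)"
    have [measurable]: "(\<lambda>x. infdist x ?S) \<in> borel_measurable borel"
      by (intro borel_measurable_continuous_onI continuous_intros)
    have d: "dim ?S \<le> card J"
      using dim_le_card'[of "(\<lambda>i. x $ i) ` J"] card_image_le[of J "\<lambda>i. x $ i"] by simp
    have im: "(\<lambda>i. if i \<in> - {j} then x $ i else y $ i) ` J = (\<lambda>i. x $ i) ` J" for y :: "real^'l^'n"
      using J by (intro image_cong) auto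
    have "(\<integral>\<^sup>+y. ?F (\<chi> i. if i \<in> - {j} then x $ i else y $ i) \<partial>std_gaussian)
        = (\<integral>\<^sup>+y. inverse (ennreal ((infdist (y $ j) ?S)\<^sup>2)) \<partial>(std_gaussian :: (real^'l^'n) measure))"
      by (simp only: vec_lambda_beta im) simp
    also have "\<dots> = (\<integral>\<^sup>+y. inverse (ennreal ((infdist y ?S)\<^sup>2)) \<partial>std_gaussian)"
      by (subst std_gaussian_marginal[OF prob_space_std_gaussian_cart, of j, symmetric], subst nn_integral_distr) auto
    also have "\<dots> \<le> ennreal (1 / (real CARD('l) - real (dim ?S) - 2))"
      by (rule nn_integral_inverse_infdist_sq) (use c d in auto)
    also have "\<dots> \<le> ennreal (1 / (real CARD('l) - real (card J) - 2))"
      using c d by (intro ennreal_leI divide_left_mono mult_pos_pos) auto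
    finally show "(\<integral>\<^sup>+y. ?F (\<chi> i. if i \<in> - {j} then x $ i else y $ i) \<partial>std_gaussian)
      \<le> ennreal (1 / (real CARD('l) - real (card J) - 2))" .
  qed
  also have "\<dots> = ennreal (1 / (real CARD('l) - real (card J) - 2))"
    using G.emeasure_space_1 by simp
  finally show ?thesis .
qed

text \<open>Every column is rotated by \<open>f\<close>. Hence the law of the sampling matrix is
  unchanged when the row space of the comparison matrix is rotated into coordinate position.\<close>

lemma orthogonal_transformation_matrix_mul_left:
  fixes f :: "real^'n \<Rightarrow> real^'n"
  assumes f: "orthogonal_transformation f"
  shows "orthogonal_transformation (\<lambda>\<Omega>::real^'l^'n. matrix f ** \<Omega>)"
  unfolding orthogonal_transformation
proof
  have lin: "linear f" and nrm: "\<And>x. norm (f x) = norm x"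
    using f by (auto simp: orthogonal_transformation)
  show "linear (\<lambda>\<Omega>::real^'l^'n. matrix f ** \<Omega>)"
    by (rule linearI) (simp_all add: vec_eq_iff matrix_matrix_mult_def sum_distrib_left
      distrib_left sum.distrib mult.left_commute)
  have "column j (matrix f ** \<Omega>) = f (column j \<Omega>)" for j and \<Omega> :: "real^'l^'n"
  proof -
    have "column j (matrix f ** \<Omega>) = matrix f *v column j \<Omega>"
      by (simp add: matrix_vector_mult_basis[symmetric] matrix_vector_mul_assoc)
    also have "\<dots> = f (column j \<Omega>)" using matrix_vector_mul(2)[OF lin] by metis
    finally show ?thesis .
  qed
  then have "(norm (matrix f ** \<Omega>))\<^sup>2 = (norm \<Omega>)\<^sup>2" for \<Omega> :: "real^'l^'n"
    by (simp add: norm_sq_columns nrm)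
  then show "\<forall>\<Omega>::real^'l^'n. norm (matrix f ** \<Omega>) = norm \<Omega>"
    by (simp add: power2_eq_iff_nonneg)
qed

lemma randomized_projector_expectation:
  fixes P :: "real^'n^'m \<Rightarrow> real^'l^'n \<Rightarrow> real^'n^'m" and V X :: "real^'n^'m"
  assumes P: "randomized_projector r P" and X: "rank X \<le> r" and r: "r \<le> CARD('n)"
    and l: "CARD('l) = r + \<rho>" and \<rho>: "\<rho> \<ge> 2"
  shows "(\<integral>\<^sup>+\<Omega>. ennreal ((norm (V - P V \<Omega>))\<^sup>2) \<partial>std_gaussian)
    \<le> ennreal ((1 + real r / (real \<rho> - 1)) * (norm (V - X))\<^sup>2)"
proof -
  let ?G = "std_gaussian :: (real^'l^'n) measure"
  interpret G: prob_space ?G by (rule prob_space_std_gaussian_rows)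
  have out: "rsvd_output r V \<Omega> (P V \<Omega>)" for \<Omega>
    using P by (simp add: randomized_projector_def)
  have Pm: "(\<lambda>(Y, \<Omega>). P Y \<Omega>) \<in> borel_measurable (borel \<Otimes>\<^sub>M borel)"
    using P unfolding randomized_projector_def borel_prod by simp
  have [measurable]: "P V \<in> borel_measurable borel"
    using measurable_compose[OF measurable_Pair1'[of V borel borel] Pm] by simp
  obtain f :: "real^'n \<Rightarrow> real^'n" and I where f: "orthogonal_transformation f" and I: "card I = r"
    and perp: "\<And>k s. k \<notin> I \<Longrightarrow> s \<in> span (rows X) \<Longrightarrow> f (axis k 1) \<bullet> s = 0"
    using adapted_orthogonal_transformation[of "span (rows X)" r] X r by (auto simp: row_rank_def)
  define g :: "real^'l^'n \<Rightarrow> real^'l^'n" where "g \<Omega> = matrix f ** \<Omega>" for \<Omega>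
  have g: "orthogonal_transformation g"
    unfolding g_def by (rule orthogonal_transformation_matrix_mul_left[OF f])
  have [measurable]: "g \<in> borel_measurable borel"
    using g by (intro borel_measurable_continuous_onI linear_continuous_on)
      (auto simp: orthogonal_transformation_def linear_conv_bounded_linear)
  define v where "v k = V *v f (axis k 1)" for k
  define s where "s = (\<Sum>k\<in>- I. (norm (v k))\<^sup>2)"
  have s0: "0 \<le> s" unfolding s_def by (rule sum_nonneg) simp
  \<comment> \<open>The directions \<open>f (axis k 1)\<close> with \<open>k\<close> outside
    \<open>I\<close> are orthogonal to the rows of \<open>X\<close>, so \<open>V\<close> and
    \<open>V - X\<close> agree on them. Thus \<open>s\<close> is a part of the squared norm of
    \<open>V - X\<close> in a rotated basis.\<close>
  have sX: "s \<le> (norm (V - X))\<^sup>2"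
  proof -
    have "X *v f (axis k 1) = 0" if "k \<notin> I" for k
      using perp[OF that span_base, of "row _ X"]
      by (auto simp: vec_eq_iff matrix_vector_mul_component rows_def row_def inner_commute vec_lambda_eta)
    then have "s = (\<Sum>k\<in>- I. (norm ((V - X) *v f (axis k 1)))\<^sup>2)"
      by (simp add: s_def v_def matrix_vector_mult_diff_rdistrib)
    also have "\<dots> \<le> (\<Sum>k\<in>UNIV. (norm ((V - X) *v f (axis k 1)))\<^sup>2)"
      by (rule sum_mono2) auto
    also have "\<dots> = (norm ((V - X) ** matrix f))\<^sup>2"
    proof -
      have "column k ((V - X) ** matrix f) = (V - X) *v f (axis k 1)" for k
        using matrix_vector_mul(2)[of f] f
        by (simp add: matrix_vector_mult_basis[symmetric] matrix_vector_mul_assoc[symmetric] orthogonal_transformation_def)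
      then show ?thesis by (simp add: norm_sq_columns)
    qed
    also have "\<dots> = (norm (V - X))\<^sup>2"
    proof -
      have "matrix f ** transpose (matrix f) = mat 1"
        using f orthogonal_transformation_matrix[of f] by (simp add: orthogonal_matrix_def)
      then have "(V - X) ** matrix f ** transpose (matrix f) = V - X"
        by (simp add: matrix_mul_assoc[symmetric])
      then show ?thesis
        using norm_matrix_mul_transpose_orthogonal[OF f, of "(V - X) ** matrix f"] by simp
    qed
    finally show ?thesis .
  qed
  define D where "D j x = infdist (x $ j) (span ((\<lambda>i. x $ i) ` (I - {j})))" for j and x :: "real^'l^'n"
  have [measurable]: "D j \<in> borel_measurable borel" for j
    unfolding D_def by measurable
  \<comment> \<open>Each row in \<open>I\<close> is compared with the span of \<open>r - 1\<close>
    others in dimension \<open>r + \<rho>\<close>. The denominator is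
    \<open>(r + \<rho>) - (r - 1) - 2 = \<rho> - 1\<close>, and \<open>\<rho> \<ge> 2\<close> gives
    the three degrees of freedom that the inverse moment requires.\<close>
  have ED: "(\<integral>\<^sup>+x. inverse (ennreal ((D j x)\<^sup>2)) \<partial>?G) \<le> ennreal (1 / (real \<rho> - 1))" if "j \<in> I" for j
  proof -
    have c: "card (I - {j}) = r - 1" using I that by simp
    have "r > 0" using I that by (metis card_gt_0_iff empty_iff finite)
    then show ?thesis
      using nn_integral_inverse_infdist_rows[where 'l = 'l, of j "I - {j}"] c l \<rho> by (simp add: D_def of_nat_diff)
  qed
  \<comment> \<open>A finite mean forces the inverse to be finite almost everywhere. This is the
    almost sure linear independence of the rows in \<open>I\<close>.\<close>
  have AE: "AE x in ?G. \<forall>j\<in>I. D j x \<noteq> 0"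
  proof (rule AE_finite_allI)
    fix j assume j: "j \<in> I"
    have "(\<integral>\<^sup>+x. inverse (ennreal ((D j x)\<^sup>2)) \<partial>?G) \<noteq> \<infinity>"
      using ED[OF j] by (auto simp: top_unique)
    then have "AE x in ?G. inverse (ennreal ((D j x)\<^sup>2)) \<noteq> \<infinity>"
      by (intro nn_integral_PInf_AE) auto
    then show "AE x in ?G. D j x \<noteq> 0" by auto
  qed simp
  let ?h = "\<lambda>\<Omega>. ennreal ((norm (V - P V \<Omega>))\<^sup>2)"
  have "(\<integral>\<^sup>+\<Omega>. ?h \<Omega> \<partial>?G) = (\<integral>\<^sup>+\<Omega>. ?h (g \<Omega>) \<partial>?G)"
    by (subst std_gaussian_distr_isometry[OF g, symmetric], subst nn_integral_distr) auto
  also have "\<dots> = (\<integral>\<^sup>+x. \<integral>\<^sup>+y. ?h (g (\<chi> i. if i \<in> I then x $ i else y $ i)) \<partial>?G \<partial>?G)"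
    by (rule std_gaussian_resample[OF prob_space_std_gaussian_cart]) measurable
  \<comment> \<open>The outer variable \<open>x\<close> fixes the rows in \<open>I\<close> and
    therefore the dual vectors, so the inner integral over \<open>y\<close> is a second moment. Its
    value \<open>s / (D j x)\<^sup>2\<close> for each \<open>j\<close> uses
    \<open>(norm (b j))\<^sup>2 = 1 / (D j x)\<^sup>2\<close>.\<close>
  also have "\<dots> \<le> (\<integral>\<^sup>+x. ennreal s + (\<Sum>j\<in>I. ennreal s * inverse (ennreal ((D j x)\<^sup>2))) \<partial>?G)"
  proof (rule nn_integral_mono_AE, use AE in eventually_elim)
    fix x :: "real^'l^'n" assume D: "\<forall>j\<in>I. D j x \<noteq> 0"
    have "\<exists>b. (norm b)\<^sup>2 = 1 / (D j x)\<^sup>2 \<and> (\<forall>i\<in>I. x $ i \<bullet> b = (if i = j then 1 else 0))" if j: "j \<in> I" for j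
    proof -
      obtain b where b: "(norm b)\<^sup>2 = 1 / (D j x)\<^sup>2" "x $ j \<bullet> b = 1"
          "\<And>t. t \<in> (\<lambda>i. x $ i) ` (I - {j}) \<Longrightarrow> t \<bullet> b = 0"
        using dual_vector_exists[of "x $ j" "(\<lambda>i. x $ i) ` (I - {j})"] D j unfolding D_def by blast
      then show ?thesis by (intro exI[of _ b]) auto
    qed
    then obtain b where b: "\<And>j. j \<in> I \<Longrightarrow> (norm (b j))\<^sup>2 = 1 / (D j x)\<^sup>2"
      "\<And>i j. i \<in> I \<Longrightarrow> j \<in> I \<Longrightarrow> x $ i \<bullet> b j = (if i = j then 1 else 0)"
      by metis
    have pt: "?h (g (\<chi> i. if i \<in> I then x $ i else y $ i))
        \<le> ennreal s + (\<Sum>j\<in>I. ennreal ((norm (\<Sum>k\<in>- I. (y $ k \<bullet> b j) *\<^sub>R v k))\<^sup>2))" for y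
    proof -
      let ?\<Omega> = "\<chi> i. if i \<in> I then x $ i else y $ i"
      have "(norm (V - P V (g ?\<Omega>)))\<^sup>2 \<le> (\<Sum>k\<in>- I. (norm (V *v f (axis k 1)))\<^sup>2)
          + (\<Sum>j\<in>I. (norm (\<Sum>k\<in>- I. (?\<Omega> $ k \<bullet> b j) *\<^sub>R (V *v f (axis k 1))))\<^sup>2)"
        using out[of "g ?\<Omega>"] I b(2) unfolding g_def by (intro rsvd_output_error[OF f, of I r]) auto
      also have "\<dots> = s + (\<Sum>j\<in>I. (norm (\<Sum>k\<in>- I. (y $ k \<bullet> b j) *\<^sub>R v k))\<^sup>2)"
        by (simp add: s_def v_def)
      finally show ?thesis
        using s0 by (simp add: ennreal_plus[symmetric] sum_nonneg ennreal_leI del: ennreal_plus)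
    qed
    have "(\<integral>\<^sup>+y. ?h (g (\<chi> i. if i \<in> I then x $ i else y $ i)) \<partial>?G)
        \<le> (\<integral>\<^sup>+y. ennreal s + (\<Sum>j\<in>I. ennreal ((norm (\<Sum>k\<in>- I. (y $ k \<bullet> b j) *\<^sub>R v k))\<^sup>2)) \<partial>?G)"
      by (intro nn_integral_mono pt)
    also have "\<dots> = ennreal s + (\<Sum>j\<in>I. \<integral>\<^sup>+y. ennreal ((norm (\<Sum>k\<in>- I. (y $ k \<bullet> b j) *\<^sub>R v k))\<^sup>2) \<partial>?G)"
      using G.emeasure_space_1 by (subst nn_integral_add) (auto simp: nn_integral_sum simp del: sum_ennreal)
    also have "\<dots> = ennreal s + (\<Sum>j\<in>I. ennreal s * inverse (ennreal ((D j x)\<^sup>2)))"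
      using D b(1) s0
      by (auto simp: nn_integral_std_gaussian_combination s_def[symmetric] inverse_ennreal ennreal_mult'[symmetric]
        divide_inverse mult.commute intro!: sum.cong)
    finally show "(\<integral>\<^sup>+y. ?h (g (\<chi> i. if i \<in> I then x $ i else y $ i)) \<partial>?G)
        \<le> ennreal s + (\<Sum>j\<in>I. ennreal s * inverse (ennreal ((D j x)\<^sup>2)))" .
  qed
  also have "\<dots> = ennreal s + (\<Sum>j\<in>I. ennreal s * (\<integral>\<^sup>+x. inverse (ennreal ((D j x)\<^sup>2)) \<partial>?G))"
    using G.emeasure_space_1 by (subst nn_integral_add) (auto simp: nn_integral_sum nn_integral_cmult)
  also have "\<dots> \<le> ennreal s + (\<Sum>j\<in>I. ennreal s * ennreal (1 / (real \<rho> - 1)))"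
    by (intro add_left_mono sum_mono mult_left_mono ED) auto
  also have "\<dots> = ennreal (s + real r * (s * (1 / (real \<rho> - 1))))"
    using s0 \<rho> I by (simp add: ennreal_mult'[symmetric] ennreal_of_nat_eq_real_of_nat ennreal_plus[symmetric] del: ennreal_plus)
  also have "s + real r * (s * (1 / (real \<rho> - 1))) = (1 + real r / (real \<rho> - 1)) * s"
    by (simp add: algebra_simps)
  also have "ennreal \<dots> \<le> ennreal ((1 + real r / (real \<rho> - 1)) * (norm (V - X))\<^sup>2)"
    using sX \<rho> by (intro ennreal_leI mult_left_mono) auto
  finally show ?thesis .
qed

section \<open>Restricted isometry and the gradient step\<close>

lemma rank_diff_le:
  fixes X Y :: "real^'n^'m"
  shows "rank (X - Y) \<le> rank X + rank Y"
proof -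
  let ?S = "{x + y |x y. x \<in> range ((*v) X) \<and> y \<in> range ((*v) Y)}"
  have sub: "subspace (range ((*v) Z))" for Z :: "real^'n^'m"
    by (intro linear_subspace_image matrix_vector_mul_linear subspace_UNIV)
  have "range ((*v) (X - Y)) \<subseteq> ?S"
  proof (rule image_subsetI)
    fix v
    have "(X - Y) *v v = X *v v + Y *v (- v)"
      by (simp add: matrix_vector_mult_diff_rdistrib linear_neg[OF matrix_vector_mul_linear])
    then show "(X - Y) *v v \<in> ?S" by blast
  qed
  then have "rank (X - Y) \<le> dim ?S"
    unfolding rank_dim_range by (rule dim_subset)
  also have "\<dots> \<le> rank X + rank Y"
    using dim_sums_Int[OF sub sub, of X Y] by (simp add: rank_dim_range)
  finally show ?thesis .
qed

text \<open>The infimum is attained because, for each fixed nonzero matrix, both inequalities say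
  that the constant is at least a certain number, and such lower bounds pass to the infimum.\<close>

lemma rip_const_bounds:
  fixes A :: "real^'n^'m \<Rightarrow> real^'p"
  assumes A: "linear A" and s: "1 \<le> s"
  shows rip_rip_const: "rip A s (rip_const A s)"
    and rip_const_nonneg: "0 \<le> rip_const A s"
    and rip_const_lower: "rip A s d \<Longrightarrow> rip_const A s \<le> d"
proof -
  have bA: "norm (A X) \<le> onorm A * norm X" for X
    using A by (simp add: onorm linear_conv_bounded_linear)
  have ne: "{d. rip A s d} \<noteq> {}"
  proof -
    \<comment> \<open>With this constant the lower inequality has a nonpositive left side, and the
      upper one follows from the operator norm.\<close>
    have "rip A s (1 + (onorm A)\<^sup>2)"
      unfolding rip_def
    proof (intro allI impI conjI)
      fix X :: "real^'n^'m"
      show "(1 - (1 + (onorm A)\<^sup>2)) * (norm X)\<^sup>2 \<le> (norm (A X))\<^sup>2"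
        by (rule order_trans[of _ 0]) (auto simp: mult_nonneg_nonneg)
      have "(norm (A X))\<^sup>2 \<le> (onorm A * norm X)\<^sup>2" by (intro power_mono bA) simp
      also have "\<dots> \<le> (1 + (1 + (onorm A)\<^sup>2)) * (norm X)\<^sup>2"
        by (simp add: power_mult_distrib distrib_right)
      finally show "(norm (A X))\<^sup>2 \<le> (1 + (1 + (onorm A)\<^sup>2)) * (norm X)\<^sup>2" .
    qed
    then show ?thesis by blast
  qed
  obtain i :: 'm and j :: 'n where True by blast
  \<comment> \<open>A matrix unit is nonzero of rank at most 1, so \<open>1 \<le> s\<close> puts it
    within reach of the isometry property. The two inequalities for it contradict each other when
    the constant is negative.\<close>
  define E where "E = (\<chi> a b. if a = i \<and> b = j then 1 else (0::real))"
  have "E $ i $ j = 1" by (simp add: E_def)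
  then have "E \<noteq> 0" by auto
  have "rows E \<subseteq> span {axis j 1}"
    by (auto simp: rows_def row_def E_def axis_def vec_eq_iff span_singleton)
  then have rE: "rank E \<le> 1"
    unfolding row_rank_def using dim_le_card[of "rows E" "{axis j 1}"] by simp
  have lb: "0 \<le> d" if "rip A s d" for d
  proof -
    have "(1 - d) * (norm E)\<^sup>2 \<le> (1 + d) * (norm E)\<^sup>2"
      using that rE s unfolding rip_def by (meson order_trans)
    then have "0 \<le> d * (norm E)\<^sup>2" by (simp add: algebra_simps)
    then show ?thesis using \<open>E \<noteq> 0\<close> by (simp add: zero_le_mult_iff)
  qed
  then have bdd: "bdd_below {d. rip A s d}" by (intro bdd_belowI[of _ 0]) auto
  show "0 \<le> rip_const A s"
    unfolding rip_const_def using ne lb by (intro cInf_greatest) auto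
  show "rip A s d \<Longrightarrow> rip_const A s \<le> d"
    unfolding rip_const_def using bdd by (intro cInf_lower) auto
  show "rip A s (rip_const A s)"
    unfolding rip_def
  proof (intro allI impI)
    fix X :: "real^'n^'m" assume X: "rank X \<le> s"
    show "(1 - rip_const A s) * (norm X)\<^sup>2 \<le> (norm (A X))\<^sup>2 \<and> (norm (A X))\<^sup>2 \<le> (1 + rip_const A s) * (norm X)\<^sup>2"
    proof (cases "X = 0")
      case True
      then show ?thesis using A by (simp add: linear_0)
    next
      case False
      then have n: "0 < (norm X)\<^sup>2" by simp
      have "1 - (norm (A X))\<^sup>2 / (norm X)\<^sup>2 \<le> rip_const A s"
        unfolding rip_const_def
      proof (rule cInf_greatest[OF ne])
        fix d assume "d \<in> {d. rip A s d}"
        then have "(1 - d) * (norm X)\<^sup>2 \<le> (norm (A X))\<^sup>2" using X by (simp add: rip_def)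
        then show "1 - (norm (A X))\<^sup>2 / (norm X)\<^sup>2 \<le> d" using n by (simp add: field_simps)
      qed
      moreover have "(norm (A X))\<^sup>2 / (norm X)\<^sup>2 - 1 \<le> rip_const A s"
        unfolding rip_const_def
      proof (rule cInf_greatest[OF ne])
        fix d assume "d \<in> {d. rip A s d}"
        then have "(norm (A X))\<^sup>2 \<le> (1 + d) * (norm X)\<^sup>2" using X by (simp add: rip_def)
        then show "(norm (A X))\<^sup>2 / (norm X)\<^sup>2 - 1 \<le> d" using n by (simp add: field_simps)
      qed
      ultimately show ?thesis using n by (simp add: field_simps)
    qed
  qed
qed

text \<open>A matrix of rank at most \<open>r\<close> is its own projection onto
  \<open>low_rank r\<close>, so under either alternative \<open>T Z\<close> is a point of
  \<open>low_rank r \<inter> K\<close> nearest to \<open>Z\<close>. Since \<open>Xs\<close> lies in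
  that set, it competes with \<open>T Z\<close>.\<close>

lemma admissible_constraint_step:
  assumes T: "T = (\<lambda>Z. Z) \<or> (\<exists>K. admissible_constraint r Xs K T)"
    and Xs: "rank Xs \<le> r" and Z: "rank Z \<le> r"
  shows "rank (T Z) \<le> r" "norm (T Z - Z) \<le> norm (Z - Xs)"
proof -
  have "rank (T Z) \<le> r \<and> norm (T Z - Z) \<le> norm (Z - Xs)"
    using T
  proof (elim disjE exE)
    assume "T = (\<lambda>Z. Z)"
    then show ?thesis using Z by simp
  next
    fix K assume adm: "admissible_constraint r Xs K T"
    then have XK: "Xs \<in> K" by (simp add: admissible_constraint_def)
    have self: "is_projection (low_rank r) Z Z"
      using Z by (simp add: is_projection_def low_rank_def)
    consider "T = closest_point K" "closed K" "is_projection (low_rank r \<inter> K) Z (T Z)"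
      | "is_projection (low_rank r \<inter> K) Z (T Z)"
      using adm self Z unfolding admissible_constraint_def low_rank_def by blast
    then have "is_projection (low_rank r \<inter> K) Z (T Z)" by cases
    then show ?thesis
      using Xs XK by (auto simp: is_projection_def low_rank_def dist_norm norm_minus_commute)
  qed
  then show "rank (T Z) \<le> r" "norm (T Z - Z) \<le> norm (Z - Xs)" by auto
qed

lemma admissible_constraint_measurable:
  assumes T: "T = (\<lambda>Z. Z) \<or> (\<exists>K. admissible_constraint r Xs K T)"
  shows "T \<in> borel_measurable borel"
  using T
proof (elim disjE exE)
  fix K assume adm: "admissible_constraint r Xs K T"
  then have K: "closed K" "convex K" "K \<noteq> {}" by (auto simp: admissible_constraint_def)
  show ?thesis
  proof (cases "T = closest_point K")
    case True
    then show ?thesis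
      using continuous_on_closest_point[OF K(2,1,3), of UNIV] by (simp add: borel_measurable_continuous_onI)
  next
    case False
    then show ?thesis using adm by (auto simp: admissible_constraint_def)
  qed
qed simp

text \<open>The deterministic side of one iteration. Differences of matrices of rank at most
  \<open>r\<close> are governed by \<open>d2\<close>; \<open>dc\<close> fixes the step size and,
  being at least \<open>d2\<close>, turns the quadratic model into an upper bound. \<open>N\<close>
  stands for the bound \<open>mn/p\<close> on the squared operator norm.\<close>

locale projected_gradient =
  fixes A :: "real^'n^'m \<Rightarrow> real^'p" and Xs :: "real^'n^'m" and y e :: "real^'p"
    and r :: nat and d2 dc N :: real
  assumes linear_A: "linear A" and rank_Xs: "rank Xs \<le> r" and y_def: "y = A Xs + e"
    and rip_2r: "rip A (2 * r) d2" and d2_nonneg: "0 \<le> d2" and d2_le_dc: "d2 \<le> dc" and dc_less_1: "dc < 1"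
    and onorm_A: "(onorm A)\<^sup>2 \<le> N"
begin

abbreviation f :: "real^'n^'m \<Rightarrow> real" where "f \<equiv> objective A y"

abbreviation g :: "real^'n^'m \<Rightarrow> real^'n^'m" where "g \<equiv> gradient A y"

definition V :: "real^'n^'m \<Rightarrow> real^'n^'m" where "V W = W - (1 / (2 * (1 + dc))) *\<^sub>R g W"

lemma norm_A_le: "norm (A X) \<le> onorm A * norm X"
  using linear_A by (simp add: onorm linear_conv_bounded_linear)

lemma rip_diff:
  assumes "rank X \<le> r" "rank Y \<le> r"
  shows "(1 - d2) * (norm (X - Y))\<^sup>2 \<le> (norm (A (X - Y)))\<^sup>2"
    and "(norm (A (X - Y)))\<^sup>2 \<le> (1 + d2) * (norm (X - Y))\<^sup>2"
  using rip_2r rank_diff_le[of X Y] assms unfolding rip_def by auto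

lemma objective_nonneg: "0 \<le> f X"
  by (simp add: objective_def)

lemma inner_gradient: "g W \<bullet> X = 2 * ((A W - y) \<bullet> A X)"
  using adjoint_works[OF linear_A] by (simp add: gradient_def inner_commute)

lemma objective_expand: "f Z = f W + g W \<bullet> (Z - W) + (norm (A (Z - W)))\<^sup>2"
proof -
  have sq: "(norm (- (p + q)))\<^sup>2 = (norm p)\<^sup>2 + 2 * (p \<bullet> q) + (norm q)\<^sup>2" for p q :: "real^'p"
    by (simp only: norm_minus_cancel power2_norm_eq_inner inner_add_left inner_add_right inner_commute[of q p])
  have "y - A Z = - ((A W - y) + A (Z - W))"
    using linear_A by (simp add: linear_diff)
  then show ?thesis
    unfolding objective_def inner_gradient using sq[of "A W - y" "A (Z - W)"]
    by (simp only: norm_minus_commute[of y "A W"])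
qed

text \<open>Pairing the gradient with itself moves the adjoint onto the other factor, so that
  Cauchy-Schwarz brings in only the operator norm of \<open>A\<close>; one factor
  \<open>norm (g W)\<close> then cancels.\<close>

lemma norm_gradient_sq_le: "(norm (g W))\<^sup>2 \<le> 4 * N * f W"
proof -
  have "(norm (g W))\<^sup>2 = 2 * ((A W - y) \<bullet> A (g W))"
    by (simp add: power2_norm_eq_inner inner_gradient)
  also have "\<dots> \<le> 2 * (norm (A W - y) * norm (A (g W)))"
    by (simp add: norm_cauchy_schwarz)
  also have "\<dots> \<le> 2 * (norm (A W - y) * (onorm A * norm (g W)))"
    by (intro mult_left_mono norm_A_le) auto
  finally have *: "norm (g W) * norm (g W) \<le> (2 * onorm A * norm (A W - y)) * norm (g W)"
    by (simp add: power2_eq_square mult_ac)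
  have o: "0 \<le> onorm A" using linear_A by (simp add: onorm_pos_le linear_conv_bounded_linear)
  have "norm (g W) \<le> 2 * onorm A * norm (A W - y)"
    using * o by (cases "norm (g W) = 0") (auto simp: mult_le_cancel_right)
  then have "(norm (g W))\<^sup>2 \<le> (2 * onorm A * norm (A W - y))\<^sup>2"
    by (rule power_mono) simp
  also have "\<dots> = 4 * (onorm A)\<^sup>2 * f W"
    by (simp add: power_mult_distrib objective_def norm_minus_commute)
  also have "\<dots> \<le> 4 * N * f W"
    using onorm_A objective_nonneg[of W] by (intro mult_right_mono) auto
  finally show ?thesis .
qed

text \<open>Completing the square in the quadratic model of curvature \<open>1 + dc\<close>; the
  last term is the decrease of the model at its minimiser \<open>V W\<close>.\<close>

lemma gradient_step_identity:
  "(1 + dc) * (norm (Z - V W))\<^sup>2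
    = (1 + dc) * (norm (Z - W))\<^sup>2 + g W \<bullet> (Z - W) + (norm (g W))\<^sup>2 / (4 * (1 + dc))"
proof -
  define m where "m = 1 / (2 * (1 + dc))"
  define D where "D = Z - W"
  have "1 + dc > 0" using d2_nonneg d2_le_dc by simp
  then have m: "(1 + dc) * m = 1 / 2" and m2: "m / 2 = 1 / (4 * (1 + dc))"
    by (simp_all add: m_def field_simps)
  have "(norm (Z - V W))\<^sup>2 = (norm (D + m *\<^sub>R g W))\<^sup>2"
    by (simp add: V_def D_def m_def algebra_simps)
  also have "\<dots> = (norm D)\<^sup>2 + 2 * m * (g W \<bullet> D) + m\<^sup>2 * (norm (g W))\<^sup>2"
    by (simp only: power2_norm_eq_inner inner_add_left inner_add_right inner_scaleR_left inner_scaleR_right)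
      (simp add: inner_commute power2_eq_square algebra_simps)
  finally have "(1 + dc) * (norm (Z - V W))\<^sup>2
      = (1 + dc) * (norm D)\<^sup>2 + 2 * ((1 + dc) * m) * (g W \<bullet> D) + ((1 + dc) * m) * m * (norm (g W))\<^sup>2"
    by (simp add: power2_eq_square algebra_simps)
  also have "\<dots> = (1 + dc) * (norm D)\<^sup>2 + g W \<bullet> D + (m / 2) * (norm (g W))\<^sup>2"
    unfolding m by simp
  finally show ?thesis unfolding m2 D_def by simp
qed

lemma descent:
  assumes "rank W \<le> r" "rank Z \<le> r"
  shows "f Z \<le> f W - (norm (g W))\<^sup>2 / (4 * (1 + dc)) + (1 + dc) * (norm (V W - Z))\<^sup>2"
proof -
  have "(norm (A (Z - W)))\<^sup>2 \<le> (1 + d2) * (norm (Z - W))\<^sup>2"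
    by (rule rip_diff) (use assms in auto)
  also have "\<dots> \<le> (1 + dc) * (norm (Z - W))\<^sup>2"
    using d2_le_dc by (intro mult_right_mono) auto
  finally show ?thesis
    using objective_expand[of Z W] gradient_step_identity[of Z W] by (simp add: norm_minus_commute)
qed

text \<open>The same identity, read at \<open>Xs\<close>, where the objective is exactly
  \<open>(norm e)\<^sup>2\<close>. The error is the gap between the model term
  \<open>(1 + dc) * (norm (Xs - W))\<^sup>2\<close> and the true quadratic term, which the lower
  isometry bound controls.\<close>

lemma gradient_step_distance:
  assumes W: "rank W \<le> r"
  shows "(1 + dc) * (norm (V W - Xs))\<^sup>2
    \<le> (norm e)\<^sup>2 - f W + (norm (g W))\<^sup>2 / (4 * (1 + dc)) + 4 * dc / (1 - d2) * (f W + (norm e)\<^sup>2)"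
proof -
  have d: "1 - d2 > 0" "0 \<le> dc" using d2_nonneg d2_le_dc dc_less_1 by auto
  let ?D = "norm (A (Xs - W))"
  have "(1 - d2) * (norm (Xs - W))\<^sup>2 \<le> ?D\<^sup>2"
    by (rule rip_diff) (use rank_Xs W in auto)
  then have "(norm (Xs - W))\<^sup>2 \<le> ?D\<^sup>2 / (1 - d2)"
    using d by (simp add: field_simps)
  then have "(1 + dc) * (norm (Xs - W))\<^sup>2 \<le> (1 + dc) * (?D\<^sup>2 / (1 - d2))"
    using d by (intro mult_left_mono) auto
  also have "(1 + dc) * (?D\<^sup>2 / (1 - d2)) - ?D\<^sup>2 = (dc + d2) / (1 - d2) * ?D\<^sup>2"
    using d by (simp add: field_simps)
  finally have 1: "(1 + dc) * (norm (Xs - W))\<^sup>2 - ?D\<^sup>2 \<le> (dc + d2) / (1 - d2) * ?D\<^sup>2"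
    using \<open>(1 + dc) * (?D\<^sup>2 / (1 - d2)) - ?D\<^sup>2 = (dc + d2) / (1 - d2) * ?D\<^sup>2\<close> by linarith
  also have "\<dots> \<le> 2 * dc / (1 - d2) * ?D\<^sup>2"
    using d d2_le_dc by (intro mult_right_mono divide_right_mono) auto
  \<comment> \<open>The residual at \<open>W\<close> and the noise are separated by
    \<open>(a + b)\<^sup>2 \<le> 2 * (a\<^sup>2 + b\<^sup>2)\<close>, which turns the coefficient 2
    into 4.\<close>
  also have "\<dots> \<le> 2 * dc / (1 - d2) * (2 * (f W + (norm e)\<^sup>2))"
  proof (intro mult_left_mono)
    have "A (Xs - W) = (y - A W) - e"
      using linear_A by (simp add: y_def linear_diff)
    then have "?D \<le> norm (y - A W) + norm e" by (simp add: norm_triangle_ineq4)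
    then have "?D\<^sup>2 \<le> (norm (y - A W) + norm e)\<^sup>2" by (rule power_mono) simp
    also have "\<dots> \<le> 2 * ((norm (y - A W))\<^sup>2 + (norm e)\<^sup>2)"
      using sum_squares_bound[of "norm (y - A W)" "norm e"] by (simp add: power2_sum)
    finally show "?D\<^sup>2 \<le> 2 * (f W + (norm e)\<^sup>2)" by (simp add: objective_def)
  qed (use d in auto)
  also have "\<dots> = 4 * dc / (1 - d2) * (f W + (norm e)\<^sup>2)"
    by (simp add: algebra_simps)
  finally have 2: "(1 + dc) * (norm (Xs - W))\<^sup>2 - ?D\<^sup>2 \<le> 4 * dc / (1 - d2) * (f W + (norm e)\<^sup>2)" .
  have "f Xs = (norm e)\<^sup>2" by (simp add: objective_def y_def)
  then show ?thesis
    using 2 objective_expand[of Xs W] gradient_step_identity[of Xs W] by (simp add: norm_minus_commute)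
qed

text \<open>The isometry bounds transfer the movement of at most \<open>norm (Z - Xs)\<close> to the
  measurements at the cost of \<open>sqrt ?k\<close>. Since \<open>1 \<le> ?k\<close>, the residual
  of \<open>Z\<close> can be put under the same root, which leaves
  \<open>sqrt ?k * (2 * ?a + ?b)\<close>.\<close>

lemma constrained_objective_le:
  assumes Z: "rank Z \<le> r" and U: "rank U \<le> r" "norm (U - Z) \<le> norm (Z - Xs)"
  shows "f U \<le> (1 + d2) / (1 - dc) * (6 * f Z + 3 * (norm e)\<^sup>2)"
proof -
  have d: "1 - d2 > 0" "1 - dc > 0" using d2_nonneg d2_le_dc dc_less_1 by auto
  let ?k = "(1 + d2) / (1 - d2)" and ?a = "norm (y - A Z)" and ?b = "norm e"
  have k1: "1 \<le> ?k" using d d2_nonneg by simp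
  have "(norm (A (U - Z)))\<^sup>2 \<le> (1 + d2) * (norm (U - Z))\<^sup>2"
    by (rule rip_diff) (use Z U in auto)
  also have "\<dots> \<le> (1 + d2) * (norm (Z - Xs))\<^sup>2"
    using U d2_nonneg by (intro mult_left_mono power_mono) auto
  also have "\<dots> \<le> (1 + d2) * ((norm (A (Z - Xs)))\<^sup>2 / (1 - d2))"
    using rip_diff(1)[OF Z rank_Xs] d d2_nonneg by (intro mult_left_mono) (auto simp: field_simps)
  also have "\<dots> = ?k * (norm (A (Z - Xs)))\<^sup>2" by simp
  also have "\<dots> \<le> ?k * (?a + ?b)\<^sup>2"
  proof (intro mult_left_mono power_mono)
    have "A (Z - Xs) = e - (y - A Z)"
      using linear_A by (simp add: y_def linear_diff)
    then show "norm (A (Z - Xs)) \<le> ?a + ?b"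
      using norm_triangle_ineq4[of e "y - A Z"] by (simp add: add.commute)
  qed (use k1 in auto)
  also have "\<dots> = (sqrt ?k * (?a + ?b))\<^sup>2"
    using k1 by (simp add: power_mult_distrib)
  finally have "norm (A (U - Z)) \<le> sqrt ?k * (?a + ?b)"
    by (rule power2_le_imp_le) (use k1 in auto)
  moreover have "norm (y - A U) \<le> norm (A (U - Z)) + ?a"
    using norm_triangle_ineq4[of "y - A Z" "A (U - Z)"] linear_A by (simp add: linear_diff)
  moreover have "?a \<le> sqrt ?k * ?a"
    using k1 by (simp add: mult_le_cancel_right1)
  ultimately have "norm (y - A U) \<le> sqrt ?k * (2 * ?a + ?b)"
    by (simp add: algebra_simps)
  then have "f U \<le> (sqrt ?k * (2 * ?a + ?b))\<^sup>2"
    unfolding objective_def by (rule power_mono) simp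
  also have "\<dots> = ?k * (2 * ?a + ?b)\<^sup>2"
    using k1 by (simp add: power_mult_distrib)
  \<comment> \<open>The cross term obeys
    \<open>4 * ?a * ?b \<le> 2 * ?a\<^sup>2 + 2 * ?b\<^sup>2\<close>, hence the constants 6 and
    3.\<close>
  also have "\<dots> \<le> ?k * (6 * f Z + 3 * ?b\<^sup>2)"
  proof (rule mult_left_mono)
    show "(2 * ?a + ?b)\<^sup>2 \<le> 6 * f Z + 3 * ?b\<^sup>2"
      using sum_squares_bound[of ?a ?b] by (simp add: objective_def power2_sum power_mult_distrib)
  qed (use k1 in auto)
  also have "\<dots> \<le> (1 + d2) / (1 - dc) * (6 * f Z + 3 * ?b\<^sup>2)"
    using d d2_nonneg d2_le_dc objective_nonneg[of Z] by (intro mult_right_mono divide_left_mono mult_pos_pos) auto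
  finally show ?thesis .
qed

text \<open>Adding the descent estimate and \<open>1 + \<epsilon>\<close> times the distance
  estimate leaves \<open>\<epsilon> * ?G - \<epsilon> * f W\<close> from the terms of opposite sign.
  The negative part is dropped and \<open>?G\<close> is bounded through the operator norm.\<close>

lemma expected_objective_le:
  fixes M :: "'w measure" and Z U :: "'w \<Rightarrow> real^'n^'m"
  assumes M: "prob_space M" and W: "rank W \<le> r" and eps: "0 \<le> \<epsilon>"
    and Z: "\<And>\<omega>. rank (Z \<omega>) \<le> r" and U: "\<And>\<omega>. rank (U \<omega>) \<le> r" "\<And>\<omega>. norm (U \<omega> - Z \<omega>) \<le> norm (Z \<omega> - Xs)"
    and int: "integrable M (\<lambda>\<omega>. (norm (V W - Z \<omega>))\<^sup>2)" "integrable M (\<lambda>\<omega>. f (U \<omega>))"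
    and exp: "(\<integral>\<omega>. (norm (V W - Z \<omega>))\<^sup>2 \<partial>M) \<le> (1 + \<epsilon>) * (norm (V W - Xs))\<^sup>2"
  shows "(\<integral>\<omega>. f (U \<omega>) \<partial>M)
    \<le> 12 * ((1 + d2) / (1 - dc)) * (\<epsilon> / (1 + dc) * N + (1 + \<epsilon>) * (3 * dc / (1 - d2))) * f W
      + (1 + d2) / (1 - dc) * (12 * (1 + \<epsilon>) * (1 + 2 * dc / (1 - d2)) + 8) * (norm e)\<^sup>2"
proof -
  interpret prob_space M by (rule M)
  let ?k = "(1 + d2) / (1 - dc)" and ?G = "(norm (g W))\<^sup>2 / (4 * (1 + dc))" and ?b = "(norm e)\<^sup>2"
  let ?q = "4 * dc / (1 - d2)"
  have d: "1 - d2 > 0" "1 - dc > 0" "1 + dc > 0" "0 \<le> dc" "0 \<le> ?k" using d2_nonneg d2_le_dc dc_less_1 by auto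
  have q0: "0 \<le> ?q" using d by simp
  have N0: "0 \<le> N" using onorm_A by (meson order_trans zero_le_power2)
  have fW: "0 \<le> f W" by (rule objective_nonneg)
  have G: "?G \<le> N / (1 + dc) * f W"
  proof -
    have "?G \<le> 4 * N * f W / (4 * (1 + dc))"
      using d by (intro divide_right_mono norm_gradient_sq_le) simp
    also have "\<dots> = N / (1 + dc) * f W"
      using d by (simp add: field_simps)
    finally show ?thesis .
  qed
  have "(\<integral>\<omega>. f (U \<omega>) \<partial>M) \<le> (\<integral>\<omega>. ?k * (6 * (f W - ?G + (1 + dc) * (norm (V W - Z \<omega>))\<^sup>2) + 3 * ?b) \<partial>M)"
  proof (rule integral_mono[OF int(2)])
    show "integrable M (\<lambda>\<omega>. ?k * (6 * (f W - ?G + (1 + dc) * (norm (V W - Z \<omega>))\<^sup>2) + 3 * ?b))"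
      using int(1) by auto
    fix \<omega>
    have "f (U \<omega>) \<le> ?k * (6 * f (Z \<omega>) + 3 * ?b)"
      by (rule constrained_objective_le[OF Z U])
    also have "\<dots> \<le> ?k * (6 * (f W - ?G + (1 + dc) * (norm (V W - Z \<omega>))\<^sup>2) + 3 * ?b)"
      using descent[OF W Z, of \<omega>] d by (intro mult_left_mono) auto
    finally show "f (U \<omega>) \<le> ?k * (6 * (f W - ?G + (1 + dc) * (norm (V W - Z \<omega>))\<^sup>2) + 3 * ?b)" .
  qed
  also have "\<dots> = ?k * (6 * (f W - ?G + (1 + dc) * (\<integral>\<omega>. (norm (V W - Z \<omega>))\<^sup>2 \<partial>M)) + 3 * ?b)"
    using int(1) by (simp add: prob_space)
  also have "\<dots> \<le> ?k * (12 * (\<epsilon> / (1 + dc) * N + (1 + \<epsilon>) * (3 * dc / (1 - d2))) * f W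
      + (12 * (1 + \<epsilon>) * (1 + 2 * dc / (1 - d2)) + 8) * ?b)"
  proof (rule mult_left_mono[OF _ d(5)])
    have expand: "(1 + \<epsilon>) * (b - F + G + q * h) = (1 + \<epsilon>) * b - F - \<epsilon> * F + G + \<epsilon> * G + (1 + \<epsilon>) * q * h"
      for b F G q h :: real
      by (simp add: algebra_simps)
    have "(1 + dc) * (\<integral>\<omega>. (norm (V W - Z \<omega>))\<^sup>2 \<partial>M) \<le> (1 + \<epsilon>) * ((1 + dc) * (norm (V W - Xs))\<^sup>2)"
      using mult_left_mono[OF exp, of "1 + dc"] d by (simp add: mult_ac)
    also have "\<dots> \<le> (1 + \<epsilon>) * (?b - f W + ?G + ?q * (f W + ?b))"
      using eps by (intro mult_left_mono gradient_step_distance[OF W]) auto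
    finally have "f W - ?G + (1 + dc) * (\<integral>\<omega>. (norm (V W - Z \<omega>))\<^sup>2 \<partial>M)
        \<le> \<epsilon> * ?G - \<epsilon> * f W + (1 + \<epsilon>) * ?b + (1 + \<epsilon>) * ?q * (f W + ?b)"
      unfolding expand by linarith
    also have "\<dots> \<le> \<epsilon> * (N / (1 + dc) * f W) + (1 + \<epsilon>) * ?b + (1 + \<epsilon>) * ?q * (f W + ?b)"
      using mult_left_mono[OF G eps] mult_nonneg_nonneg[OF eps fW] by linarith
    finally have 1: "6 * (f W - ?G + (1 + dc) * (\<integral>\<omega>. (norm (V W - Z \<omega>))\<^sup>2 \<partial>M)) + 3 * ?b
        \<le> 6 * (\<epsilon> * (N / (1 + dc) * f W) + (1 + \<epsilon>) * ?b + (1 + \<epsilon>) * ?q * (f W + ?b)) + 3 * ?b"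
      by simp
    define u where "u = \<epsilon> * (N / (1 + dc) * f W)"
    define w where "w = (1 + \<epsilon>) * ?q"
    have u0: "0 \<le> u" unfolding u_def using eps N0 d fW by (intro mult_nonneg_nonneg divide_nonneg_pos) auto
    have w0: "0 \<le> w" unfolding w_def using eps q0 by (intro mult_nonneg_nonneg) auto
    \<comment> \<open>Since \<open>?q = 4 * dc / (1 - d2)\<close>, the stated \<open>12 * 3\<close>
      is 9 times, and \<open>12 * 2\<close> is 6 times, the factor in \<open>w\<close>. The estimate
      has 6 in both places, so the comparison is termwise.\<close>
    have rhs: "12 * (\<epsilon> / (1 + dc) * N + (1 + \<epsilon>) * (3 * dc / (1 - d2))) * f W
        + (12 * (1 + \<epsilon>) * (1 + 2 * dc / (1 - d2)) + 8) * ?b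
      = 12 * u + 9 * (w * f W) + (12 * ((1 + \<epsilon>) * ?b) + 6 * (w * ?b) + 8 * ?b)"
      by (simp add: u_def w_def algebra_simps add_divide_distrib)
    have arith: "0 \<le> u \<Longrightarrow> 0 \<le> p \<Longrightarrow> 0 \<le> x \<Longrightarrow> 0 \<le> b
        \<Longrightarrow> 6 * (u + x + (p + t)) + 3 * b \<le> 12 * u + 9 * p + (12 * x + 6 * t + 8 * b)" for u p x b t :: real
      by simp
    have "0 \<le> w * f W" "0 \<le> (1 + \<epsilon>) * ?b" "0 \<le> ?b"
      using w0 fW eps by auto
    then have "6 * (u + (1 + \<epsilon>) * ?b + w * (f W + ?b)) + 3 * ?b
        \<le> 12 * u + 9 * (w * f W) + (12 * ((1 + \<epsilon>) * ?b) + 6 * (w * ?b) + 8 * ?b)"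
      using u0 arith[of u "w * f W" "(1 + \<epsilon>) * ?b" ?b "w * ?b"] by (simp only: distrib_left[of w])
    then show "6 * (f W - ?G + (1 + dc) * (\<integral>\<omega>. (norm (V W - Z \<omega>))\<^sup>2 \<partial>M)) + 3 * ?b
        \<le> 12 * (\<epsilon> / (1 + dc) * N + (1 + \<epsilon>) * (3 * dc / (1 - d2))) * f W
          + (12 * (1 + \<epsilon>) * (1 + 2 * dc / (1 - d2)) + 8) * ?b"
      unfolding rhs using 1[folded u_def w_def] by (rule order_trans[rotated])
  qed
  also have "k * (12 * a * F + t * b) = 12 * k * a * F + k * t * b" for k a F t b :: real
    by (simp add: algebra_simps)
  finally show ?thesis .
qed

end

section \<open>Law and independence of the iterates\<close>

lemma iid_standard_gaussian_measurable:
  assumes G: "iid_standard_gaussian M G"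
  shows "G i \<in> borel_measurable M"
proof -
  have "(\<lambda>\<omega>. G i \<omega> $ j $ k) \<in> borel_measurable M" for j k
    using G by (auto simp: iid_standard_gaussian_def distributed_def)
  then have "(\<lambda>\<omega>. \<chi> j. \<chi> k. G i \<omega> $ j $ k) \<in> borel_measurable M"
    by (intro measurable_vec_lambda)
  then show ?thesis by simp
qed

lemma (in prob_space) distr_vec_indep:
  fixes X :: "'i::finite \<Rightarrow> 'a \<Rightarrow> 'b::euclidean_space"
  assumes P: "prob_space (std_gaussian :: 'b measure)"
    and ind: "indep_vars (\<lambda>_. borel) X UNIV" and X: "\<And>i. distr M borel (X i) = std_gaussian"
  shows "distr M borel (\<lambda>\<omega>. \<chi> i. X i \<omega>) = std_gaussian"
proof -
  have [measurable]: "X i \<in> borel_measurable M" for i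
    using ind by (auto simp: indep_vars_def2)
  have m [measurable]: "(\<lambda>x. \<chi> i. x i) \<in> borel_measurable (PiM UNIV (\<lambda>_::'i. borel :: 'b measure))"
    by measurable
  have "distr M (PiM UNIV (\<lambda>_. borel)) (\<lambda>\<omega>. \<lambda>i\<in>UNIV. X i \<omega>) = PiM UNIV (\<lambda>i. distr M borel (X i))"
    using ind by (subst (asm) indep_vars_iff_distr_eq_PiM) auto
  then have D: "distr M (PiM UNIV (\<lambda>_. borel)) (\<lambda>\<omega> i. X i \<omega>) = PiM UNIV (\<lambda>_. std_gaussian)"
    by (simp only: X restrict_UNIV)
  have "distr M borel (\<lambda>\<omega>. \<chi> i. X i \<omega>) = distr (distr M (PiM UNIV (\<lambda>_. borel)) (\<lambda>\<omega> i. X i \<omega>)) borel vec_lambda"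
    using m by (subst distr_distr) (auto simp: comp_def intro!: measurable_PiM_single')
  then show ?thesis
    unfolding D std_gaussian_vec[OF P] .
qed

text \<open>Grouping the index triples into disjoint blocks transfers independence first to the
  entries of a row and then to the rows, and on each level the components assemble to a standard
  Gaussian.\<close>

lemma (in prob_space) iid_standard_gaussian_law:
  fixes G :: "nat \<Rightarrow> 'a \<Rightarrow> real^'l^'n"
  assumes G: "iid_standard_gaussian M G"
  shows "distr M borel (G i) = std_gaussian"
proof -
  have ind: "indep_vars (\<lambda>_. borel) (\<lambda>(i, j, k) \<omega>. G i \<omega> $ j $ k) (UNIV :: (nat \<times> 'n \<times> 'l) set)"
    using G by (simp add: iid_standard_gaussian_def)
  have entry: "distr M borel (\<lambda>\<omega>. G i \<omega> $ j $ k) = std_gaussian" for j k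
    using G by (auto simp: iid_standard_gaussian_def distributed_def std_gaussian_real cong: distr_cong)
  let ?e = "\<lambda>(i, j, k) \<omega>. G i \<omega> $ j $ k"
  have row_ind: "indep_vars (\<lambda>_. borel) (\<lambda>k \<omega>. G i \<omega> $ j $ k) UNIV" for j
  proof -
    have "indep_vars (\<lambda>k. PiM {(i, j, k)} (\<lambda>_. borel)) (\<lambda>k \<omega>. restrict (\<lambda>p. ?e p \<omega>) {(i, j, k)}) (UNIV :: 'l set)"
      using ind by (rule indep_vars_restrict) (auto simp: disjoint_family_on_def)
    from indep_vars_compose2[OF this, of "\<lambda>k x. x (i, j, k)" "\<lambda>_. borel"] show ?thesis by simp
  qed
  have row: "distr M borel (\<lambda>\<omega>. G i \<omega> $ j) = std_gaussian" for j
    using distr_vec_indep[OF prob_space_std_gaussian_real row_ind entry, of j] by simp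
  have rows: "indep_vars (\<lambda>j. PiM ({i} \<times> {j} \<times> UNIV) (\<lambda>_. borel)) (\<lambda>j \<omega>. restrict (\<lambda>p. ?e p \<omega>) ({i} \<times> {j} \<times> UNIV)) (UNIV :: 'n set)"
    using ind by (rule indep_vars_restrict) (auto simp: disjoint_family_on_def)
  have "(\<lambda>x. \<chi> k. x (i, j, k)) \<in> borel_measurable (PiM ({i} \<times> {j} \<times> (UNIV :: 'l set)) (\<lambda>_. borel :: real measure))" for j :: 'n
    by (intro measurable_vec_lambda measurable_component_singleton) auto
  from indep_vars_compose2[OF rows this]
  have "indep_vars (\<lambda>_. borel) (\<lambda>j \<omega>. \<chi> k. restrict (\<lambda>p. ?e p \<omega>) ({i} \<times> {j} \<times> UNIV) (i, j, k)) (UNIV :: 'n set)" .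
  then have "indep_vars (\<lambda>_. borel) (\<lambda>j \<omega>. G i \<omega> $ j) UNIV" by simp
  from distr_vec_indep[OF prob_space_std_gaussian_cart this row] show ?thesis by simp
qed

text \<open>By induction the iterate with index \<open>i\<close> is a measurable function of the
  entries of \<open>G 0\<close> to \<open>G (i - 1)\<close>. This index block is disjoint from the
  entries of \<open>G i\<close>, so the iterate and the next draw are independent.\<close>

lemma (in prob_space) iid_standard_gaussian_recursion:
  fixes G :: "nat \<Rightarrow> 'a \<Rightarrow> real^'l^'n" and X :: "nat \<Rightarrow> 'a \<Rightarrow> 'b::euclidean_space"
  assumes G: "iid_standard_gaussian M G"
    and step: "(\<lambda>(x, \<Omega>). step x \<Omega>) \<in> borel_measurable (borel \<Otimes>\<^sub>M borel)"
    and X0: "\<And>\<omega>. \<omega> \<in> space M \<Longrightarrow> X 0 \<omega> = x0"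
    and X: "\<And>i \<omega>. \<omega> \<in> space M \<Longrightarrow> X (Suc i) \<omega> = step (X i \<omega>) (G i \<omega>)"
  shows "X i \<in> borel_measurable M"
    and "distr M (borel \<Otimes>\<^sub>M borel) (\<lambda>\<omega>. (X i \<omega>, G i \<omega>)) = distr M borel (X i) \<Otimes>\<^sub>M distr M borel (G i)"
proof -
  let ?e = "\<lambda>(i, j, k) \<omega>. G i \<omega> $ j $ k"
  let ?past = "\<lambda>i. {..<i} \<times> (UNIV :: ('n \<times> 'l) set)"
  have ind: "indep_vars (\<lambda>_. borel) ?e (UNIV :: (nat \<times> 'n \<times> 'l) set)"
    using G by (simp add: iid_standard_gaussian_def)
  have "\<exists>h \<in> borel_measurable (PiM (?past i) (\<lambda>_. borel)). \<forall>\<omega>\<in>space M. X i \<omega> = h (restrict (\<lambda>p. ?e p \<omega>) (?past i))"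
  proof (induction i)
    case 0
    then show ?case using X0 by (intro bexI[of _ "\<lambda>_. x0"]) auto
  next
    case (Suc i)
    then obtain h where h: "h \<in> borel_measurable (PiM (?past i) (\<lambda>_. borel))"
      and hX: "\<And>\<omega>. \<omega> \<in> space M \<Longrightarrow> X i \<omega> = h (restrict (\<lambda>p. ?e p \<omega>) (?past i))" by blast
    define h' where "h' p = step (h (restrict p (?past i))) (\<chi> j. \<chi> k. p (i, j, k))" for p
    have "(\<lambda>p. (h (restrict p (?past i)), \<chi> j. \<chi> k. p (i, j, k)))
        \<in> measurable (PiM (?past (Suc i)) (\<lambda>_. borel :: real measure)) (borel \<Otimes>\<^sub>M borel)"
    proof (rule measurable_Pair)
      show "(\<lambda>p. h (restrict p (?past i))) \<in> borel_measurable (PiM (?past (Suc i)) (\<lambda>_. borel))"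
        by (rule measurable_compose[OF measurable_restrict_subset h]) auto
      show "(\<lambda>p. \<chi> j. \<chi> k. p (i, j, k)) \<in> borel_measurable (PiM (?past (Suc i)) (\<lambda>_. borel :: real measure))"
        by (intro measurable_vec_lambda measurable_component_singleton) auto
    qed
    from measurable_compose[OF this step]
    have h': "h' \<in> borel_measurable (PiM (?past (Suc i)) (\<lambda>_. borel))"
      by (simp add: h'_def[abs_def])
    have sub: "?past i \<subseteq> ?past (Suc i)" by auto
    have "X (Suc i) \<omega> = h' (restrict (\<lambda>p. ?e p \<omega>) (?past (Suc i)))" if "\<omega> \<in> space M" for \<omega>
    proof -
      have "restrict (restrict (\<lambda>p. ?e p \<omega>) (?past (Suc i))) (?past i) = restrict (\<lambda>p. ?e p \<omega>) (?past i)"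
        using sub by (simp add: Int_absorb1)
      then show ?thesis
        unfolding h'_def using that by (simp add: X hX)
    qed
    with h' show ?case by blast
  qed
  then obtain h where h: "h \<in> borel_measurable (PiM (?past i) (\<lambda>_. borel))"
    and hX: "\<And>\<omega>. \<omega> \<in> space M \<Longrightarrow> X i \<omega> = h (restrict (\<lambda>p. ?e p \<omega>) (?past i))" by blast
  let ?now = "{i} \<times> (UNIV :: ('n \<times> 'l) set)"
  let ?A = "PiM (?past i) (\<lambda>_. borel) :: (nat \<times> 'n \<times> 'l \<Rightarrow> real) measure"
  let ?B = "PiM ?now (\<lambda>_. borel) :: (nat \<times> 'n \<times> 'l \<Rightarrow> real) measure"
  let ?a = "\<lambda>\<omega>. restrict (\<lambda>p. ?e p \<omega>) (?past i)" and ?b = "\<lambda>\<omega>. restrict (\<lambda>p. ?e p \<omega>) ?now"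
  let ?k = "\<lambda>p :: nat \<times> 'n \<times> 'l \<Rightarrow> real. \<chi> j. \<chi> k. p (i, j, k)"
  have "indep_var ?A ?a ?B ?b"
    using ind by (rule indep_var_restrict) auto
  then have ab [measurable]: "?a \<in> measurable M ?A" "?b \<in> measurable M ?B"
    and joint: "distr M ?A ?a \<Otimes>\<^sub>M distr M ?B ?b = distr M (?A \<Otimes>\<^sub>M ?B) (\<lambda>\<omega>. (?a \<omega>, ?b \<omega>))"
    unfolding indep_var_distribution_eq by auto
  note [measurable] = h
  have k [measurable]: "?k \<in> borel_measurable ?B"
    by (intro measurable_vec_lambda measurable_component_singleton) auto
  have kG: "?k (?b \<omega>) = G i \<omega>" for \<omega> by simp
  have XM: "X i \<in> borel_measurable M \<longleftrightarrow> (\<lambda>\<omega>. h (?a \<omega>)) \<in> borel_measurable M"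
    using hX by (intro measurable_cong)
  then show "X i \<in> borel_measurable M"
    using measurable_compose[OF ab(1) h] by simp
  have dX: "distr M borel (X i) = distr (distr M ?A ?a) borel h"
    using hX by (subst distr_distr) (auto intro!: distr_cong simp: comp_def)
  have dG: "distr M borel (G i) = distr (distr M ?B ?b) borel ?k"
    by (subst distr_distr) (auto intro!: distr_cong simp: comp_def)
  interpret dG: prob_space "distr (distr M ?B ?b) borel ?k"
    unfolding dG[symmetric] by (intro prob_space_distr iid_standard_gaussian_measurable[OF G])
  have "distr M borel (X i) \<Otimes>\<^sub>M distr M borel (G i)
      = distr (distr M ?A ?a \<Otimes>\<^sub>M distr M ?B ?b) (borel \<Otimes>\<^sub>M borel) (\<lambda>(x, y). (h x, ?k y))"
    unfolding dX dG by (rule pair_measure_distr) (auto intro: dG.sigma_finite_measure_axioms)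
  also have "\<dots> = distr M (borel \<Otimes>\<^sub>M borel) (\<lambda>\<omega>. (h (?a \<omega>), ?k (?b \<omega>)))"
    unfolding joint by (subst distr_distr) (auto simp: comp_def)
  also have "\<dots> = distr M (borel \<Otimes>\<^sub>M borel) (\<lambda>\<omega>. (X i \<omega>, G i \<omega>))"
    using hX by (intro distr_cong) (auto simp: kG)
  finally show "distr M (borel \<Otimes>\<^sub>M borel) (\<lambda>\<omega>. (X i \<omega>, G i \<omega>))
      = distr M borel (X i) \<Otimes>\<^sub>M distr M borel (G i)" ..
qed

text \<open>The tower property in the form of Fubini on the product law. The bound \<open>le\<close>
  is asked only at values that \<open>X\<close> takes; this matters because the one-step estimate
  holds for matrices of rank at most \<open>r\<close>.\<close>

lemma (in prob_space) integral_indep_le: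
  fixes F :: "'b::euclidean_space \<Rightarrow> 'c::euclidean_space \<Rightarrow> real"
  assumes XY [measurable]: "X \<in> borel_measurable M" "Y \<in> borel_measurable M"
    and joint: "distr M (borel \<Otimes>\<^sub>M borel) (\<lambda>\<omega>. (X \<omega>, Y \<omega>)) = distr M borel X \<Otimes>\<^sub>M distr M borel Y"
    and F: "(\<lambda>(x, y). F x y) \<in> borel_measurable (borel \<Otimes>\<^sub>M borel)"
    and bdd: "\<And>\<omega> y. \<omega> \<in> space M \<Longrightarrow> \<bar>F (X \<omega>) y\<bar> \<le> B"
    and le: "\<And>\<omega>. \<omega> \<in> space M \<Longrightarrow> (\<integral>y. F (X \<omega>) y \<partial>distr M borel Y) \<le> H (X \<omega>)"
    and H: "integrable M (\<lambda>\<omega>. H (X \<omega>))"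
  shows "(\<integral>\<omega>. F (X \<omega>) (Y \<omega>) \<partial>M) \<le> (\<integral>\<omega>. H (X \<omega>) \<partial>M)"
proof -
  note [measurable] = F
  interpret DX: prob_space "distr M borel X" by (rule prob_space_distr) simp
  interpret DY: prob_space "distr M borel Y" by (rule prob_space_distr) simp
  interpret DXY: pair_sigma_finite "distr M borel X" "distr M borel Y" ..
  have "integrable M (\<lambda>\<omega>. F (X \<omega>) (Y \<omega>))"
    by (rule integrable_const_bound[of _ B]) (auto intro!: bdd AE_I2)
  then have int: "integrable (distr M borel X \<Otimes>\<^sub>M distr M borel Y) (\<lambda>(x, y). F x y)"
    unfolding joint[symmetric] by (subst integrable_distr_eq) (auto simp: split_def)
  have mI: "(\<lambda>x. \<integral>y. F x y \<partial>distr M borel Y) \<in> borel_measurable borel"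
    by measurable
  have "(\<integral>\<omega>. F (X \<omega>) (Y \<omega>) \<partial>M) = (\<integral>z. (case z of (x, y) \<Rightarrow> F x y) \<partial>(distr M borel X \<Otimes>\<^sub>M distr M borel Y))"
    unfolding joint[symmetric] by (subst integral_distr) (auto simp: split_def)
  also have "\<dots> = (\<integral>x. \<integral>y. F x y \<partial>distr M borel Y \<partial>distr M borel X)"
    using DXY.integral_fst'[OF int] by simp
  also have "\<dots> = (\<integral>\<omega>. \<integral>y. F (X \<omega>) y \<partial>distr M borel Y \<partial>M)"
    using mI by (subst integral_distr) auto
  also have "\<dots> \<le> (\<integral>\<omega>. H (X \<omega>) \<partial>M)"
  proof (rule integral_mono[OF _ H le])
    have "integrable (distr M borel X) (\<lambda>x. \<integral>y. F x y \<partial>distr M borel Y)"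
      using DXY.integrable_fst'[OF int] by simp
    then show "integrable M (\<lambda>\<omega>. \<integral>y. F (X \<omega>) y \<partial>distr M borel Y)"
      using mI by (subst (asm) integrable_distr_eq) auto
  qed
  finally show ?thesis .
qed

text \<open>\<open>?L\<close> is the fixed point of the affine map, and the excess over it shrinks
  at least by the factor \<open>\<theta>\<close> in each step.\<close>

lemma limsup_affine_recursion_le:
  fixes a :: "nat \<Rightarrow> real"
  assumes rec: "\<And>i. a (Suc i) \<le> \<theta> * a i + \<tau>" and \<theta>: "0 \<le> \<theta>" "\<theta> < 1"
  shows "limsup (\<lambda>i. ereal (a i)) \<le> ereal (\<tau> / (1 - \<theta>))"
proof -
  let ?L = "\<tau> / (1 - \<theta>)"
  have L: "\<theta> * ?L + \<tau> = ?L" using \<theta> by (simp add: field_simps)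
  have bound: "a i \<le> \<theta> ^ i * (a 0 - ?L) + ?L" for i
  proof (induction i)
    case (Suc i)
    have "a (Suc i) \<le> \<theta> * a i + \<tau>" by (rule rec)
    also have "\<dots> \<le> \<theta> * (\<theta> ^ i * (a 0 - ?L) + ?L) + \<tau>"
      using Suc \<theta> by (intro add_right_mono mult_left_mono) auto
    also have "\<dots> = \<theta> ^ Suc i * (a 0 - ?L) + (\<theta> * ?L + \<tau>)" by (simp add: distrib_left mult.assoc)
    finally show ?case unfolding L .
  qed simp
  have "(\<lambda>i. \<theta> ^ i * (a 0 - ?L) + ?L) \<longlonglongrightarrow> 0 * (a 0 - ?L) + ?L"
    using \<theta> by (intro tendsto_intros LIMSEQ_realpow_zero)
  then have "limsup (\<lambda>i. ereal (\<theta> ^ i * (a 0 - ?L) + ?L)) = ereal ?L"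
    by (intro lim_imp_Limsup) auto
  moreover have "limsup (\<lambda>i. ereal (a i)) \<le> limsup (\<lambda>i. ereal (\<theta> ^ i * (a 0 - ?L) + ?L))"
    by (intro Limsup_mono always_eventually) (use bound in auto)
  ultimately show ?thesis by simp
qed

section \<open>One-step estimate for the iteration and the limit of the expected objective\<close>

lemma rsvd_output_rank_le: "rsvd_output r V \<Omega> Z \<Longrightarrow> rank Z \<le> r"
  by (auto simp: rsvd_output_def is_projection_def low_rank_def)

lemma objective_le:
  fixes A :: "real^'n^'m \<Rightarrow> real^'p"
  assumes "linear A"
  shows "objective A y X \<le> (norm y + onorm A * norm X)\<^sup>2"
  unfolding objective_def
proof (rule power_mono)
  show "norm (y - A X) \<le> norm y + onorm A * norm X"
    using norm_triangle_ineq4[of y "A X"] onorm[of A X] assms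
    by (simp add: linear_conv_bounded_linear)
qed simp

lemma continuous_on_gradient:
  fixes A :: "real^'n^'m \<Rightarrow> real^'p"
  assumes A: "linear A"
  shows "continuous_on UNIV (gradient A y)"
proof -
  have "bounded_linear A" "bounded_linear (adjoint A)"
    using A adjoint_linear[OF A] by (simp_all add: linear_conv_bounded_linear)
  then show ?thesis
    unfolding gradient_def[abs_def]
    by (intro continuous_intros linear_continuous_on bounded_linear.continuous_on[where f = "adjoint A"])
qed

lemma continuous_on_objective:
  fixes A :: "real^'n^'m \<Rightarrow> real^'p"
  assumes "linear A"
  shows "continuous_on UNIV (objective A y)"
  unfolding objective_def[abs_def]
  using assms by (intro continuous_intros linear_continuous_on) (simp add: linear_conv_bounded_linear)

theorem theorem2:
  fixes A :: "real^'n^'m \<Rightarrow> real^'p"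
    and Xs X0 :: "real^'n^'m"
    and y e :: "real^'p"
    and r \<rho> c :: nat
    and \<epsilon> C d2 dc \<mu> :: real
    and M :: "'w measure"
    and G :: "nat \<Rightarrow> 'w \<Rightarrow> real^'l^'n"
    and P :: "real^'n^'m \<Rightarrow> real^'l^'n \<Rightarrow> real^'n^'m"
    and T :: "real^'n^'m \<Rightarrow> real^'n^'m"
    and step :: "real^'n^'m \<Rightarrow> real^'l^'n \<Rightarrow> real^'n^'m"
    and X :: "nat \<Rightarrow> 'w \<Rightarrow> real^'n^'m"
    and f :: "real^'n^'m \<Rightarrow> real"
  assumes "linear A"
    and "rank Xs = r"
    and "y = A Xs + e"
    and "f = objective A y"
    and "\<rho> \<ge> 2"
    and "CARD('l) = r + \<rho>"
    and "CARD('l) \<le> min CARD('m) CARD('n)"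
    and "\<epsilon> = real r / (real \<rho> - 1)"
    and "CARD('l) = (c - 1) * r"
    and "d2 = rip_const A (2 * r)" and "d2 < 1"
    and "dc = rip_const A (c * r)" and "dc < 1"
    and "(onorm A)\<^sup>2 \<le> real CARD('m) * real CARD('n) / real CARD('p)"
    and "prob_space M"
    and "iid_standard_gaussian M G"
    and "randomized_projector r P"
    and "T = (\<lambda>Z. Z) \<or> (\<exists>K. admissible_constraint r Xs K T)"
    and "\<mu> = 1 / (2 * (1 + dc))"
    and "step = (\<lambda>Z \<Omega>. T (P (Z - \<mu> *\<^sub>R gradient A y Z) \<Omega>))"
    and "rank X0 \<le> r"
    and "\<And>\<omega>. \<omega> \<in> space M \<Longrightarrow> X 0 \<omega> = X0"
    and "\<And>i \<omega>. \<omega> \<in> space M \<Longrightarrow> X (Suc i) \<omega> = step (X i \<omega>) (G i \<omega>)"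
    and "C \<ge> 4"
  shows "\<exists>\<theta> \<tau> :: real.
      \<theta> \<le> 12 * ((1 + d2) / (1 - dc)) *
            (\<epsilon> / (1 + dc) * (real CARD('m) * real CARD('n) / real CARD('p))
              + (1 + \<epsilon>) * (3 * dc / (1 - d2))) \<and>
      \<tau> \<le> (1 + d2) / (1 - dc) * (12 * (1 + \<epsilon>) * (1 + 2 * dc / (1 - d2)) + 8) \<and>
      (\<forall>i. \<forall>\<omega>\<in>space M. f (X i \<omega>) > C\<^sup>2 * (norm e)\<^sup>2 \<longrightarrow>
         integrable M (\<lambda>\<omega>'. f (step (X i \<omega>) (G i \<omega>'))) \<and>
         (\<integral>\<omega>'. f (step (X i \<omega>) (G i \<omega>')) \<partial>M) \<le> \<theta> * f (X i \<omega>) + \<tau> * (norm e)\<^sup>2) \<and>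
      (\<forall>i. integrable M (\<lambda>\<omega>. f (X i \<omega>))) \<and>
      (\<forall>t_inf. \<theta> \<le> t_inf \<and> t_inf < 1 \<longrightarrow>
         limsup (\<lambda>i. ereal (\<integral>\<omega>. f (X i \<omega>) \<partial>M))
           \<le> ereal (max (C\<^sup>2) (\<tau> / (1 - t_inf)) * (norm e)\<^sup>2))"
proof -
  interpret prob_space M by fact
  let ?G = "std_gaussian :: (real^'l^'n) measure"
  let ?N = "real CARD('m) * real CARD('n) / real CARD('p)"
  interpret G: prob_space ?G by (rule prob_space_std_gaussian_rows)
  have "r \<noteq> 0"
  proof
    assume "r = 0"
    then have "CARD('l) = 0" using assms(9) by simp
    then show False by simp
  qed
  then have r1: "1 \<le> r" by simp
  \<comment> \<open>Subtraction is truncated, so \<open>c < 2\<close> would give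
    \<open>(c - 1) * r = 0\<close>, while \<open>'l\<close> is nonempty. From
    \<open>2 * r \<le> c * r\<close> the constant \<open>dc\<close> is admissible at rank
    \<open>2 * r\<close>, hence \<open>d2 \<le> dc\<close>.\<close>
  have c2: "2 \<le> c"
  proof (rule ccontr)
    assume "\<not> 2 \<le> c"
    then have "c - 1 = 0" by simp
    then show False using assms(9) by (simp only: mult_0) simp
  qed
  then have rc: "2 * r \<le> c * r" by simp
  have rip_c: "rip A (c * r) dc"
    unfolding assms(12) by (rule rip_rip_const[OF assms(1)]) (use rc r1 in linarith)
  then have rip_dc: "rip A (2 * r) dc"
    using rc unfolding rip_def by (meson order_trans)
  have r2: "1 \<le> 2 * r" using r1 by simp
  interpret PG: projected_gradient A Xs y e r d2 dc ?N
  proof (rule projected_gradient.intro)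
    show "rip A (2 * r) d2" unfolding assms(10) by (rule rip_rip_const[OF assms(1) r2])
    show "0 \<le> d2" unfolding assms(10) by (rule rip_const_nonneg[OF assms(1) r2])
    show "d2 \<le> dc" unfolding assms(10) by (rule rip_const_lower[OF assms(1) r2 rip_dc])
  qed (use assms(1,2,3,13,14) in simp_all)
  have d: "0 \<le> d2" "d2 < 1" "0 \<le> dc" "dc < 1"
    using PG.d2_nonneg PG.d2_le_dc assms(13) by auto
  have eps: "0 \<le> \<epsilon>" using assms(5,8) by simp
  have Xs: "rank Xs \<le> r" using assms(2) by simp
  \<comment> \<open>Both witnesses are the stated bounds themselves, so the two required
    inequalities hold with equality.\<close>
  define \<theta> where "\<theta> = 12 * ((1 + d2) / (1 - dc)) * (\<epsilon> / (1 + dc) * ?N + (1 + \<epsilon>) * (3 * dc / (1 - d2)))"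
  define \<tau> where "\<tau> = (1 + d2) / (1 - dc) * (12 * (1 + \<epsilon>) * (1 + 2 * dc / (1 - d2)) + 8)"
  have \<theta>0: "0 \<le> \<theta>" and \<tau>0: "0 \<le> \<tau>"
    unfolding \<theta>_def \<tau>_def using d eps by auto

  have out: "rsvd_output r Y \<Omega> (P Y \<Omega>)" for Y \<Omega>
    using assms(17) by (simp add: randomized_projector_def)
  have Pm: "(\<lambda>(Y, \<Omega>). P Y \<Omega>) \<in> borel_measurable (borel \<Otimes>\<^sub>M borel)"
    using assms(17) unfolding randomized_projector_def borel_prod by simp
  have rankP: "rank (P Y \<Omega>) \<le> r" for Y \<Omega> by (rule rsvd_output_rank_le[OF out])
  have rankT: "rank (T (P Y \<Omega>)) \<le> r" and distT: "norm (T (P Y \<Omega>) - P Y \<Omega>) \<le> norm (P Y \<Omega> - Xs)" for Y \<Omega>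
    by (rule admissible_constraint_step[OF assms(18) Xs rankP])+
  have [measurable]: "T \<in> borel_measurable borel"
    by (rule admissible_constraint_measurable[OF assms(18)])
  have step: "step W \<Omega> = T (P (PG.V W) \<Omega>)" for W \<Omega>
    by (simp add: assms(19,20) PG.V_def)
  have Vc: "continuous_on UNIV PG.V"
    unfolding PG.V_def[abs_def] by (intro continuous_intros continuous_on_gradient assms)
  then have [measurable]: "PG.V \<in> borel_measurable borel"
    by (rule borel_measurable_continuous_onI)
  have [measurable]: "f \<in> borel_measurable borel"
    unfolding assms(4) by (intro borel_measurable_continuous_onI continuous_on_objective assms)
  have "(\<lambda>z. P (PG.V (fst z)) (snd z)) \<in> borel_measurable (borel \<Otimes>\<^sub>M (borel :: (real^'l^'n) measure))"
    using measurable_compose[OF _ Pm, of "\<lambda>z. (PG.V (fst z), snd z)" "borel \<Otimes>\<^sub>M borel"] by simp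
  then have stepm [measurable]: "(\<lambda>(x, \<Omega>). step x \<Omega>) \<in> borel_measurable (borel \<Otimes>\<^sub>M borel)"
    by (simp add: step split_def)

  have Z_bound: "norm (PG.V W - P (PG.V W) \<Omega>) \<le> norm (PG.V W)" for W \<Omega>
    by (rule rsvd_output_norm_le[OF out])
  \<comment> \<open>The projector gives \<open>norm ?Z \<le> 2 * norm (PG.V W)\<close>, and the map
    after it gives \<open>norm (T ?Z) \<le> 2 * norm ?Z + norm Xs\<close>. The bound is uniform in
    the drawn matrix; since \<open>PG.V\<close> is bounded on balls, every iterate is bounded by a
    constant depending only on its index.\<close>
  have step_le: "norm (step W \<Omega>) \<le> 4 * norm (PG.V W) + norm Xs" for W \<Omega>
  proof -
    let ?Z = "P (PG.V W) \<Omega>"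
    have "norm ?Z \<le> 2 * norm (PG.V W)"
      using norm_triangle_sub[of ?Z "PG.V W"] Z_bound[of W \<Omega>] by (simp add: norm_minus_commute)
    moreover have "norm (T ?Z) \<le> norm ?Z + norm (?Z - Xs)"
      using norm_triangle_sub[of "T ?Z" ?Z] distT[of "PG.V W" \<Omega>] by simp
    ultimately show ?thesis
      using norm_triangle_ineq4[of ?Z Xs] by (simp add: step)
  qed
  have step_bdd: "\<exists>B'. \<forall>W \<Omega>. norm W \<le> B \<longrightarrow> norm (step W \<Omega>) \<le> B'" for B
  proof -
    have "compact (PG.V ` cball 0 B)"
      by (intro compact_continuous_image continuous_on_subset[OF Vc]) auto
    from compact_imp_bounded[OF this] obtain K where K: "\<forall>z\<in>PG.V ` cball 0 B. norm z \<le> K"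
      unfolding bounded_iff by blast
    have "norm (step W \<Omega>) \<le> 4 * K + norm Xs" if "norm W \<le> B" for W \<Omega>
    proof -
      have "norm (PG.V W) \<le> K" using K that by simp
      then show ?thesis using step_le[of W \<Omega>] by simp
    qed
    then show ?thesis by blast
  qed
  have f_le: "\<bar>f W\<bar> \<le> (norm y + onorm A * B)\<^sup>2" if "norm W \<le> B" for W B
  proof -
    have "0 \<le> onorm A"
      using assms(1) by (simp add: onorm_pos_le linear_conv_bounded_linear)
    then have "(norm y + onorm A * norm W)\<^sup>2 \<le> (norm y + onorm A * B)\<^sup>2"
      using that by (intro power_mono add_left_mono mult_left_mono) auto
    then show ?thesis
      using objective_le[OF assms(1), of y W] PG.objective_nonneg[of W] by (simp add: assms(4))
  qed
  have f_step_bdd: "\<exists>B'. \<forall>W \<Omega>. norm W \<le> B \<longrightarrow> \<bar>f (step W \<Omega>)\<bar> \<le> B'" for B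
    using step_bdd[of B] f_le by blast

  have one_step_int: "integrable ?G (\<lambda>\<Omega>. f (step W \<Omega>))" for W
  proof -
    obtain B where "\<And>\<Omega>. \<bar>f (step W \<Omega>)\<bar> \<le> B" using f_step_bdd[of "norm W"] by blast
    then show ?thesis by (intro G.integrable_const_bound[of _ B]) auto
  qed
  have one_step: "(\<integral>\<Omega>. f (step W \<Omega>) \<partial>?G) \<le> \<theta> * f W + \<tau> * (norm e)\<^sup>2" if W: "rank W \<le> r" for W
  proof -
    have m [measurable]: "P (PG.V W) \<in> borel_measurable borel"
      using measurable_compose[OF measurable_Pair1'[of "PG.V W" borel borel] Pm] by simp
    have int: "integrable ?G (\<lambda>\<Omega>. (norm (PG.V W - P (PG.V W) \<Omega>))\<^sup>2)"
      using power_mono[OF Z_bound, of W _ 2]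
      by (intro G.integrable_const_bound[of _ "(norm (PG.V W))\<^sup>2"]) auto
    have "ennreal (\<integral>\<Omega>. (norm (PG.V W - P (PG.V W) \<Omega>))\<^sup>2 \<partial>?G)
        = (\<integral>\<^sup>+\<Omega>. ennreal ((norm (PG.V W - P (PG.V W) \<Omega>))\<^sup>2) \<partial>?G)"
      by (rule nn_integral_eq_integral[OF int, symmetric]) simp
    also have "\<dots> \<le> ennreal ((1 + \<epsilon>) * (norm (PG.V W - Xs))\<^sup>2)"
      unfolding assms(8) by (rule randomized_projector_expectation[OF assms(17) Xs]) (use assms(5-7) in auto)
    finally have exp: "(\<integral>\<Omega>. (norm (PG.V W - P (PG.V W) \<Omega>))\<^sup>2 \<partial>?G) \<le> (1 + \<epsilon>) * (norm (PG.V W - Xs))\<^sup>2"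
      using eps by (simp add: ennreal_le_iff)
    show ?thesis
      using PG.expected_objective_le[OF G.prob_space_axioms W eps rankP rankT distT int _ exp] one_step_int[of W]
      unfolding \<theta>_def \<tau>_def assms(4) step by blast
  qed

  have X_rank: "rank (X i \<omega>) \<le> r" if "\<omega> \<in> space M" for i \<omega>
    using that by (cases i) (simp_all add: assms(21,22,23) step rankT)
  have X_bdd: "\<exists>B. \<forall>\<omega>\<in>space M. norm (X i \<omega>) \<le> B" for i
  proof (induction i)
    case 0
    then show ?case using assms(22) by auto
  next
    case (Suc i)
    then obtain B where B: "\<And>\<omega>. \<omega> \<in> space M \<Longrightarrow> norm (X i \<omega>) \<le> B" by blast
    obtain B' where "\<And>W \<Omega>. norm W \<le> B \<Longrightarrow> norm (step W \<Omega>) \<le> B'" using step_bdd by blast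
    then show ?case using B assms(23) by (intro exI[of _ B']) simp
  qed
  note rec = iid_standard_gaussian_recursion[OF assms(16) stepm, of X X0, OF assms(22,23)]
  have [measurable]: "X i \<in> borel_measurable M" for i by (rule rec)
  have [measurable]: "G i \<in> borel_measurable M" for i
    by (rule iid_standard_gaussian_measurable[OF assms(16)])
  note law = iid_standard_gaussian_law[OF assms(16)]
  have int_fX: "integrable M (\<lambda>\<omega>. f (X i \<omega>))" for i
  proof -
    obtain B where "\<And>\<omega>. \<omega> \<in> space M \<Longrightarrow> norm (X i \<omega>) \<le> B" using X_bdd by blast
    then show ?thesis
      by (intro integrable_const_bound[of _ "(norm y + onorm A * B)\<^sup>2"]) (auto intro!: AE_I2 f_le)
  qed

  \<comment> \<open>The current iterate is frozen at \<open>\<omega>\<close> while the draw is taken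
    at an independent variable \<open>\<omega>'\<close>, so the integral over
    \<open>\<omega>'\<close> is an integral against the Gaussian law.\<close>
  have conditional: "integrable M (\<lambda>\<omega>'. f (step (X i \<omega>) (G i \<omega>'))) \<and>
      (\<integral>\<omega>'. f (step (X i \<omega>) (G i \<omega>')) \<partial>M) \<le> \<theta> * f (X i \<omega>) + \<tau> * (norm e)\<^sup>2"
    if "\<omega> \<in> space M" for i \<omega>
  proof -
    have m: "(\<lambda>\<Omega>. f (step (X i \<omega>) \<Omega>)) \<in> borel_measurable borel"
      using one_step_int[of "X i \<omega>"] by (simp add: borel_measurable_integrable measurable_cong_sets[OF sets_std_gaussian refl, symmetric])
    have "integrable (distr M borel (G i)) (\<lambda>\<Omega>. f (step (X i \<omega>) \<Omega>))"
      unfolding law by (rule one_step_int)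
    moreover have "(\<integral>\<omega>'. f (step (X i \<omega>) (G i \<omega>')) \<partial>M) = (\<integral>\<Omega>. f (step (X i \<omega>) \<Omega>) \<partial>distr M borel (G i))"
      using m by (subst integral_distr) auto
    ultimately show ?thesis
      using m one_step[OF X_rank[OF that]] by (subst (asm) integrable_distr_eq) (auto simp: law)
  qed

  have recursion: "(\<integral>\<omega>. f (X (Suc i) \<omega>) \<partial>M) \<le> \<theta> * (\<integral>\<omega>. f (X i \<omega>) \<partial>M) + \<tau> * (norm e)\<^sup>2" for i
  proof -
    obtain B where "\<And>\<omega>. \<omega> \<in> space M \<Longrightarrow> norm (X i \<omega>) \<le> B" using X_bdd by blast
    then obtain B' where B': "\<And>\<omega> \<Omega>. \<omega> \<in> space M \<Longrightarrow> \<bar>f (step (X i \<omega>) \<Omega>)\<bar> \<le> B'"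
      using f_step_bdd by meson
    have "(\<integral>\<omega>. f (X (Suc i) \<omega>) \<partial>M) = (\<integral>\<omega>. f (step (X i \<omega>) (G i \<omega>)) \<partial>M)"
      by (rule Bochner_Integration.integral_cong) (auto simp: assms(23))
    also have "\<dots> \<le> (\<integral>\<omega>. \<theta> * f (X i \<omega>) + \<tau> * (norm e)\<^sup>2 \<partial>M)"
    proof (rule integral_indep_le[where F = "\<lambda>x \<Omega>. f (step x \<Omega>)" and H = "\<lambda>x. \<theta> * f x + \<tau> * (norm e)\<^sup>2"])
      show "distr M (borel \<Otimes>\<^sub>M borel) (\<lambda>\<omega>. (X i \<omega>, G i \<omega>)) = distr M borel (X i) \<Otimes>\<^sub>M distr M borel (G i)"
        by (rule rec)
      show "(\<integral>\<Omega>. f (step (X i \<omega>) \<Omega>) \<partial>distr M borel (G i)) \<le> \<theta> * f (X i \<omega>) + \<tau> * (norm e)\<^sup>2"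
        if "\<omega> \<in> space M" for \<omega>
        unfolding law by (rule one_step[OF X_rank[OF that]])
      show "(\<lambda>(x, \<Omega>). f (step x \<Omega>)) \<in> borel_measurable (borel \<Otimes>\<^sub>M borel)"
        using measurable_compose[OF stepm, of f borel] by (simp add: split_def)
    qed (use B' int_fX in auto)
    also have "\<dots> = \<theta> * (\<integral>\<omega>. f (X i \<omega>) \<partial>M) + \<tau> * (norm e)\<^sup>2"
      using int_fX by (simp add: prob_space)
    finally show ?thesis .
  qed
  have limit: "limsup (\<lambda>i. ereal (\<integral>\<omega>. f (X i \<omega>) \<partial>M)) \<le> ereal (max (C\<^sup>2) (\<tau> / (1 - t)) * (norm e)\<^sup>2)"
    if t: "\<theta> \<le> t" "t < 1" for t
  proof -
    have "limsup (\<lambda>i. ereal (\<integral>\<omega>. f (X i \<omega>) \<partial>M)) \<le> ereal (\<tau> * (norm e)\<^sup>2 / (1 - \<theta>))"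
      using \<theta>0 t by (intro limsup_affine_recursion_le recursion) auto
    \<comment> \<open>Since \<open>\<tau> \<ge> 0\<close>, replacing \<open>\<theta>\<close> by the
      larger contraction factor \<open>t\<close> only raises the fixed point of the
      recursion.\<close>
    also have "\<tau> * (norm e)\<^sup>2 / (1 - \<theta>) \<le> \<tau> * (norm e)\<^sup>2 / (1 - t)"
      using t \<tau>0 by (intro divide_left_mono) auto
    also have "\<dots> = \<tau> / (1 - t) * (norm e)\<^sup>2" by simp
    also have "\<dots> \<le> max (C\<^sup>2) (\<tau> / (1 - t)) * (norm e)\<^sup>2"
      by (intro mult_right_mono) auto
    finally show ?thesis by simp
  qed
  show ?thesis
    using conditional int_fX limit
    by (intro exI[of _ \<theta>] exI[of _ \<tau>]) (auto simp: \<theta>_def \<tau>_def)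
qed

end
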